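(* Consider the SPD Q-learning algorithm described in the context. Assume that $\gamma_k=\gamma_0/\sqrt{k+1}$, $k\ge 0$, with some $\gamma_0>0$, that $\beta_k=\beta_0/(k+1)$, $k\ge 0$, for any real number $\beta_0>0$ (so that $\|M_k^{-1}-M_{k+1}^{-1}\|_2\le \beta_0/(k+1)$ for all $k\ge0$), and let $\eta=\frac{\sigma}{|\mathcal S|}\mathbf 1_{|\mathcal S|}$. For any $\varepsilon\in(0,1)$ and $\delta\in(0,1/e)$, where $e$ is Euler's number, if $$T\ge \kappa\,\frac{\sigma^4|\mathcal S|^4|\mathcal A|^4}{\zeta^4(1-\alpha)^4}\,\frac{1}{\varepsilon^2}\ln\left(\frac1\delta\right),$$ then with probability at least $1-\delta$ we have $D(\hat x_T,\hat y_T)\le\varepsilon$, where $\kappa:=\max\{\kappa_1,\kappa_2\}$, $$\kappa_1:=\left(\frac{12+4\beta_0}{\zeta^2|\mathcal S|^2|\mathcal A|^2\gamma_0}+26\gamma_0\right)^2,$$ $$\kappa_2:=(2184+416\sqrt{26})\gamma_0^2+(1066+416\sqrt{26})\gamma_0+832+16\sqrt{26}.$$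
   Context: **Discounted MDP.** $\mathcal S=\{1,\dots,|\mathcal S|\}$ and $\mathcal A=\{1,\dots,|\mathcal A|\}$ are finite state and action sets, $\alpha\in[0,1)$ is the discount factor, $P_a\in\mathbb R^{|\mathcal S|\times|\mathcal S|}$ ($a\in\mathcal A$) are row-stochastic transition matrices, $\hat r_{ss'a}\in[0,\sigma]$ are random rewards with mean $r_{ss'a}$, and $\sigma\ge1$. Put $R_a(s)=\sum_{s'}P_a(s,s')r_{ss'a}$; $P\in\mathbb R^{|\mathcal S||\mathcal A|\times|\mathcal S|}$ and $R\in\mathbb R^{|\mathcal S||\mathcal A|}$ are the $P_a$ and $R_a$ stacked over $a$. $\eta\in\mathbb R^{|\mathcal S|}$ has positive entries. Vectors $Q,\lambda,\mu\in\mathbb R^{|\mathcal S||\mathcal A|}$ have blocks $Q_a,\lambda_a,\mu_a\in\mathbb R^{|\mathcal S|}$, $a\in\mathcal A$. $V^*$ is the optimal value function, $Q_a^*=R_a+\alpha P_aV^*$, and $\lambda^*$ is the optimal solution of the dual LP $\max_{\lambda\ge0}\lambda^TR$ s.t. $\eta+\alpha P^T\lambda=(\mathbf 1_{|\mathcal A|}\otimes I_{|\mathcal S|})^T\lambda$. **State-action distributions.** The trajectory $(s_k,a_k)_{k\ge0}$ is observed from the environment, and $\tau_{a,k}(s)$ is the probability that the state and action at time $k$ are $(s,a)$; $\tau_k$ denotes this distribution. $M_k\in\mathbb R^{|\mathcal S||\mathcal A|\times|\mathcal S||\mathcal A|}$ is the diagonal matrix with diagonal blocks $\mathrm{diag}(\tau_{a,k}(1),\dots,\tau_{a,k}(|\mathcal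 S|))$, $a\in\mathcal A$ (a deterministic sequence of matrices); $\bar M_k=\mathrm{diag}(I_{|\mathcal S||\mathcal A|},M_k)$. Assumptions: there is $\zeta>0$ with $\tau_{a,k}(s)\ge\zeta$ for all $k\ge0$, $s$, $a$; $M_k$ converges to a positive diagonal matrix $M_\infty$; there is a non-increasing sequence $\beta_k\to0$ with $\|M_k^{-1}-M_{k+1}^{-1}\|_2\le\beta_k$ for all $k\ge0$; the step sizes $\gamma_k$ are non-increasing with $\gamma_k\to0$. **Sets.** $\mathcal V=\{v\in\mathbb R^{|\mathcal S|}:v\ge0,\|v\|_\infty\le\frac{\sigma}{1-\alpha}\}$, $\mathcal L=\{\lambda\in\mathbb R^{|\mathcal S||\mathcal A|}:\lambda\ge0,\|\lambda\|_\infty\le\frac{\|\eta\|_1}{1-\alpha}\}$, $\mathcal M=\{\mu\in\mathbb R^{|\mathcal S||\mathcal A|}:\mu\ge0,\|\mu\|_\infty\le\frac{\|\eta\|_1}{\zeta(1-\alpha)}\}$, $\Xi=\{\lambda:\sum_a\lambda_a\ge\eta\}$, $\mathcal X=\mathcal V^{|\mathcal A|}\times\mathcal V$, $\mathcal Y=(\mathcal L\cap\Xi)\times\mathcal M$. Write $x=(Q,V)$, $y=(\lambda,\mu)$. $\Pi$ denotes Euclidean projection. **SPD Q-learning algorithm.** Initialize $V^{(0)}$ and $Q^{(0)}$ with entries in $[0,\frac{\sigma}{1-\alpha}]$, $\lambda^{(0)}$ with entries in $[0,\frac{\|\eta\|_1}{1-\alpha}]$, $\mu^{(0)}$ with entries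 in $[0,\frac{\|\eta\|_1}{\zeta(1-\alpha)}]$. Write $x_k=(Q^{(k)},V^{(k)})$, $y_k=(\lambda^{(k)},\mu^{(k)})$. At step $k=0,\dots,T-1$, observe $(s_k,a_k,s_{k+1},\hat r_{s_ks_{k+1}a_k})$ from the environment, where $(s_k,a_k)\sim\tau_k$ and $s_{k+1}$ is the next state, and sample $\hat s_k$ and $\hat a_k$ uniformly from $\mathcal S$ and $\mathcal A$. With $e_s$ the basis vectors of $\mathbb R^{|\mathcal S|}$ and $E_{s,a}$ the basis vector of $\mathbb R^{|\mathcal S||\mathcal A|}$ for the $s$-th entry of block $a$, set $$g^x_k=\begin{bmatrix}|\mathcal S||\mathcal A|\lambda^{(k)}_{\hat a_k}(\hat s_k)E_{\hat s_k,\hat a_k}-\mu^{(k)}_{a_k}(s_k)E_{s_k,a_k}\\ |\mathcal S|\eta(\hat s_k)e_{\hat s_k}-|\mathcal S||\mathcal A|\lambda^{(k)}_{\hat a_k}(\hat s_k)e_{\hat s_k}+\alpha\mu^{(k)}_{a_k}(s_k)e_{s_{k+1}}\end{bmatrix},$$ $$g^y_k=\begin{bmatrix}|\mathcal S||\mathcal A|(Q^{(k)}_{\hat a_k}(\hat s_k)-V^{(k)}(\hat s_k))E_{\hat s_k,\hat a_k}\\ (\alpha V^{(k)}(s_{k+1})+\hat r_{s_ks_{k+1}a_k}-Q^{(k)}_{a_k}(s_k))E_{s_k,a_k}\end{bmatrix},$$ and $x_{k+1}=\Pi_{\mathcal X}(x_k-\gamma_kg^x_k)$, $y_{k+1}=\Pi_{\mathcal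 Y}(y_k+\gamma_kg^y_k)$. With $L_{M_k}(x,y)=\eta^TV+\mu^TM_k(\alpha PV+R-Q)+\lambda^T(Q-(\mathbf 1_{|\mathcal A|}\otimes I_{|\mathcal S|})V)$, these are regarded as unbiased stochastic gradients $g_k^x=\nabla_xL_{M_k}(x_k,y_k)+\varepsilon_k$, $g_k^y=\nabla_yL_{M_k}(x_k,y_k)+\xi_k$, where $(\varepsilon_k,\xi_k)$ are (possibly dependent) random variables with zero mean. **Averages and gap.** $\hat x_T=\frac1T\sum_{k=0}^{T-1}x_k$, $\hat y_T=\frac1T\sum_{k=0}^{T-1}\bar M_ky_k$. $L_I(x,y)=\eta^TV+\mu^T(\alpha PV+R-Q)+\lambda^T(Q-(\mathbf 1_{|\mathcal A|}\otimes I_{|\mathcal S|})V)$. The pseudo duality gap is $D(x,y)=L_I(x,y^* )-L_I(x^*,y)$, where $(x^*,y^* )\in\mathcal X\times\mathcal Y$, $x^*=(Q^*,V^* )$, $y^*=(\lambda^*,\lambda^* )$, is the solution of the saddle point problem $\min_{x\in\mathcal X}\max_{y\in\mathcal Y}L_I(x,y)=\max_{y\in\mathcal Y}\min_{x\in\mathcal X}L_I(x,y)$. *)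

theory Defs
  imports "HOL-Probability.Probability"
begin

text \<open>
  States and actions are the elements of finite types \<open>'s\<close> and \<open>'a\<close>. A vector of dimension
  $|S||A|$ is indexed by pairs: the entry \<open>(s, a)\<close> is the \<open>s\<close>-th entry of block \<open>a\<close>.
\<close>

type_synonym ('s, 'a) primal = "(real ^ ('s \<times> 'a)) \<times> (real ^ 's)"
type_synonym ('s, 'a) dual = "(real ^ ('s \<times> 'a)) \<times> (real ^ ('s \<times> 'a))"

definition row_stochastic :: "real ^ 'n::finite ^ 'n \<Rightarrow> bool" where
  "row_stochastic A \<longleftrightarrow> (\<forall>i j. 0 \<le> A $ i $ j) \<and> (\<forall>i. (\<Sum>j\<in>UNIV. A $ i $ j) = 1)"

definition stacked_P :: "('a::finite \<Rightarrow> real ^ 's::finite ^ 's) \<Rightarrow> real ^ 's ^ ('s \<times> 'a)" where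
  "stacked_P P = (\<chi> i. P (snd i) $ fst i)"

text \<open>\<open>r s s' a\<close> is the mean reward of the transition from \<open>s\<close> to \<open>s'\<close> under action \<open>a\<close>.\<close>

definition stacked_R ::
  "('a::finite \<Rightarrow> real ^ 's::finite ^ 's) \<Rightarrow> ('s \<Rightarrow> 's \<Rightarrow> 'a \<Rightarrow> real) \<Rightarrow> real ^ ('s \<times> 'a)" where
  "stacked_R P r = (\<chi> i. \<Sum>s'\<in>UNIV. P (snd i) $ fst i $ s' * r (fst i) s' (snd i))"

text \<open>The matrix $\mathbf 1_{|A|} \otimes I_{|S|}$.\<close>

definition stacked_I :: "real ^ 's::finite ^ ('s \<times> 'a::finite)" where
  "stacked_I = (\<chi> i s. if fst i = s then 1 else 0)"

text \<open>Expected reward at time \<open>t\<close> of the chain controlled by the deterministic stationary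
  policy \<open>\<pi>\<close> and started in \<open>s\<close>.\<close>

primrec expected_reward ::
  "('a::finite \<Rightarrow> real ^ 's::finite ^ 's) \<Rightarrow> real ^ ('s \<times> 'a) \<Rightarrow> ('s \<Rightarrow> 'a) \<Rightarrow> nat \<Rightarrow> 's \<Rightarrow> real" where
  "expected_reward P R \<pi> 0 s = R $ (s, \<pi> s)"
| "expected_reward P R \<pi> (Suc t) s =
     (\<Sum>s'\<in>UNIV. P (\<pi> s) $ s $ s' * expected_reward P R \<pi> t s')"

definition policy_value ::
  "real \<Rightarrow> ('a::finite \<Rightarrow> real ^ 's::finite ^ 's) \<Rightarrow> real ^ ('s \<times> 'a) \<Rightarrow> ('s \<Rightarrow> 'a) \<Rightarrow> 's \<Rightarrow> real" where
  "policy_value \<alpha> P R \<pi> s = (\<Sum>t. \<alpha> ^ t * expected_reward P R \<pi> t s)"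

definition optimal_V ::
  "real \<Rightarrow> ('a::finite \<Rightarrow> real ^ 's ^ 's::finite) \<Rightarrow> real ^ ('s \<times> 'a) \<Rightarrow> real ^ 's" where
  "optimal_V \<alpha> P R = (\<chi> s. MAX \<pi>\<in>UNIV. policy_value \<alpha> P R \<pi> s)"

definition optimal_Q ::
  "real \<Rightarrow> ('a::finite \<Rightarrow> real ^ 's ^ 's::finite) \<Rightarrow> real ^ ('s \<times> 'a) \<Rightarrow> real ^ ('s \<times> 'a)" where
  "optimal_Q \<alpha> P R = R + \<alpha> *\<^sub>R (stacked_P P *v optimal_V \<alpha> P R)"

definition dual_feasible ::
  "real \<Rightarrow> real ^ 's \<Rightarrow> ('a::finite \<Rightarrow> real ^ 's ^ 's::finite) \<Rightarrow> real ^ ('s \<times> 'a) \<Rightarrow> bool" where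
  "dual_feasible \<alpha> \<eta> P l \<longleftrightarrow> (\<forall>i. 0 \<le> l $ i) \<and>
     \<eta> + \<alpha> *\<^sub>R (transpose (stacked_P P) *v l) = transpose stacked_I *v l"

definition dual_optimal ::
  "real \<Rightarrow> real ^ 's \<Rightarrow> ('a::finite \<Rightarrow> real ^ 's ^ 's::finite) \<Rightarrow> real ^ ('s \<times> 'a) \<Rightarrow>
   real ^ ('s \<times> 'a) \<Rightarrow> bool" where
  "dual_optimal \<alpha> \<eta> P R l \<longleftrightarrow> dual_feasible \<alpha> \<eta> P l \<and>
     (\<forall>l'. dual_feasible \<alpha> \<eta> P l' \<longrightarrow> l' \<bullet> R \<le> l \<bullet> R)"

definition dist_matrix :: "('s::finite \<Rightarrow> 'a::finite \<Rightarrow> real) \<Rightarrow> real ^ ('s \<times> 'a) ^ ('s \<times> 'a)" where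
  "dist_matrix \<tau> = (\<chi> i j. if i = j then \<tau> (fst i) (snd i) else 0)"

definition lagrangian ::
  "real \<Rightarrow> real ^ 's \<Rightarrow> ('a::finite \<Rightarrow> real ^ 's ^ 's::finite) \<Rightarrow> real ^ ('s \<times> 'a) \<Rightarrow>
   real ^ ('s \<times> 'a) ^ ('s \<times> 'a) \<Rightarrow> ('s, 'a) primal \<Rightarrow> ('s, 'a) dual \<Rightarrow> real" where
  "lagrangian \<alpha> \<eta> P R M x y = (case x of (Q, V) \<Rightarrow> case y of (l, m) \<Rightarrow>
     \<eta> \<bullet> V + m \<bullet> (M *v (\<alpha> *\<^sub>R (stacked_P P *v V) + R - Q)) + l \<bullet> (Q - stacked_I *v V))"

definition grad :: "('v::real_inner \<Rightarrow> real) \<Rightarrow> 'v \<Rightarrow> 'v" where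
  "grad f x = (THE D. GDERIV f x :> D)"

text \<open>The gap relative to the saddle point $((Q^*, V^*), (\lambda^*, \lambda^*))$. An optimal
  \<open>ls\<close> of the dual linear program need not be unique, so it is a parameter.\<close>

definition pseudo_gap ::
  "real \<Rightarrow> real ^ 's \<Rightarrow> ('a::finite \<Rightarrow> real ^ 's ^ 's::finite) \<Rightarrow> real ^ ('s \<times> 'a) \<Rightarrow>
   real ^ ('s \<times> 'a) \<Rightarrow> ('s, 'a) primal \<Rightarrow> ('s, 'a) dual \<Rightarrow> real" where
  "pseudo_gap \<alpha> \<eta> P R ls x y =
     lagrangian \<alpha> \<eta> P R (mat 1) x (ls, ls) -
     lagrangian \<alpha> \<eta> P R (mat 1) (optimal_Q \<alpha> P R, optimal_V \<alpha> P R) y"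

definition norm1 :: "real ^ 'n::finite \<Rightarrow> real" where
  "norm1 v = (\<Sum>i\<in>UNIV. \<bar>v $ i\<bar>)"

definition nonneg_box :: "real \<Rightarrow> (real ^ 'n::finite) set" where
  "nonneg_box c = {v. (\<forall>i. 0 \<le> v $ i) \<and> infnorm v \<le> c}"

definition V_set :: "real \<Rightarrow> real \<Rightarrow> (real ^ 's::finite) set" where
  "V_set \<alpha> \<sigma> = nonneg_box (\<sigma> / (1 - \<alpha>))"

definition L_set :: "real \<Rightarrow> real ^ 's::finite \<Rightarrow> (real ^ ('s \<times> 'a::finite)) set" where
  "L_set \<alpha> \<eta> = nonneg_box (norm1 \<eta> / (1 - \<alpha>))"

definition M_set :: "real \<Rightarrow> real \<Rightarrow> real ^ 's::finite \<Rightarrow> (real ^ ('s \<times> 'a::finite)) set" where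
  "M_set \<alpha> \<zeta> \<eta> = nonneg_box (norm1 \<eta> / (\<zeta> * (1 - \<alpha>)))"

definition Xi_set :: "real ^ 's::finite \<Rightarrow> (real ^ ('s \<times> 'a::finite)) set" where
  "Xi_set \<eta> = {l. \<forall>s. \<eta> $ s \<le> (\<Sum>a\<in>UNIV. l $ (s, a))}"

definition X_set :: "real \<Rightarrow> real \<Rightarrow> ('s::finite, 'a::finite) primal set" where
  "X_set \<alpha> \<sigma> = {Q. \<forall>a. (\<chi> s. Q $ (s, a)) \<in> V_set \<alpha> \<sigma>} \<times> V_set \<alpha> \<sigma>"

definition Y_set :: "real \<Rightarrow> real \<Rightarrow> real ^ 's::finite \<Rightarrow> ('s, 'a::finite) dual set" where
  "Y_set \<alpha> \<zeta> \<eta> = (L_set \<alpha> \<eta> \<inter> Xi_set \<eta>) \<times> M_set \<alpha> \<zeta> \<eta>"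

text \<open>Arguments of the stochastic gradients: \<open>(s, a)\<close> is the observed state-action pair, \<open>s'\<close> the
  observed next state, \<open>rew\<close> the observed reward and \<open>(sh, ah)\<close> the uniformly sampled pair.\<close>

definition gx ::
  "real \<Rightarrow> real ^ 's \<Rightarrow> 's \<Rightarrow> 'a \<Rightarrow> 's \<Rightarrow> 's \<Rightarrow> 'a \<Rightarrow>
   ('s::finite, 'a::finite) dual \<Rightarrow> ('s, 'a) primal" where
  "gx \<alpha> \<eta> s a s' sh ah y = (case y of (l, m) \<Rightarrow>
     ((real CARD('s) * real CARD('a) * l $ (sh, ah)) *\<^sub>R axis (sh, ah) 1
        - (m $ (s, a)) *\<^sub>R axis (s, a) 1,
      (real CARD('s) * \<eta> $ sh) *\<^sub>R axis sh 1
        - (real CARD('s) * real CARD('a) * l $ (sh, ah)) *\<^sub>R axis sh 1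
        + (\<alpha> * m $ (s, a)) *\<^sub>R axis s' 1))"

definition gy ::
  "real \<Rightarrow> 's \<Rightarrow> 'a \<Rightarrow> 's \<Rightarrow> real \<Rightarrow> 's \<Rightarrow> 'a \<Rightarrow>
   ('s::finite, 'a::finite) primal \<Rightarrow> ('s, 'a) dual" where
  "gy \<alpha> s a s' rew sh ah x = (case x of (Q, V) \<Rightarrow>
     ((real CARD('s) * real CARD('a) * (Q $ (sh, ah) - V $ sh)) *\<^sub>R axis (sh, ah) 1,
      (\<alpha> * V $ s' + rew - Q $ (s, a)) *\<^sub>R axis (s, a) 1))"

text \<open>Vector-valued noise \<open>Z\<close> with zero mean conditionally on the information \<open>G\<close>.\<close>

definition cond_mean_zero :: "'w measure \<Rightarrow> 'w measure \<Rightarrow> ('w \<Rightarrow> 'v::euclidean_space) \<Rightarrow> bool" where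
  "cond_mean_zero W G Z \<longleftrightarrow>
     (\<forall>b\<in>Basis. integrable W (\<lambda>\<omega>. Z \<omega> \<bullet> b) \<and>
        (AE \<omega> in W. real_cond_exp W G (\<lambda>\<omega>. Z \<omega> \<bullet> b) \<omega> = 0))"

definition x_average :: "(nat \<Rightarrow> ('s::finite, 'a::finite) primal) \<Rightarrow> nat \<Rightarrow> ('s, 'a) primal" where
  "x_average x T = (1 / real T) *\<^sub>R (\<Sum>k<T. x k)"

text \<open>The block matrix $\mathrm{diag}(I, M_k)$ is applied blockwise to $(\lambda, \mu)$.\<close>

definition y_average ::
  "(nat \<Rightarrow> real ^ ('s \<times> 'a) ^ ('s \<times> 'a)) \<Rightarrow> (nat \<Rightarrow> ('s::finite, 'a::finite) dual) \<Rightarrow> nat \<Rightarrow>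
   ('s, 'a) dual" where
  "y_average M y T = (1 / real T) *\<^sub>R (\<Sum>k<T. (fst (y k), M k *v snd (y k)))"

text \<open>The arguments \<open>nS\<close> and \<open>nA\<close> are the numbers of states and actions.\<close>

definition kappa1 :: "real \<Rightarrow> real \<Rightarrow> real \<Rightarrow> real \<Rightarrow> real \<Rightarrow> real" where
  "kappa1 nS nA \<zeta> \<beta>0 \<gamma>0 =
     ((12 + 4 * \<beta>0) / (\<zeta>^2 * nS^2 * nA^2 * \<gamma>0) + 26 * \<gamma>0)^2"

definition kappa2 :: "real \<Rightarrow> real" where
  "kappa2 \<gamma>0 = (2184 + 416 * sqrt 26) * \<gamma>0^2 + (1066 + 416 * sqrt 26) * \<gamma>0 + 832 + 16 * sqrt 26"

end

theory Submission
  imports Defs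
begin

text \<open>
  Since $\lambda^*$ is dual feasible, $L_{M_k}(x, (\lambda^*, M_k^{-1}\lambda^*)) = R^T\lambda^*$
  for every $x$. The gap of the averages is therefore the average of the numbers
  $m_k = R^T\lambda^* - L_{M_k}(x^*, y_k)$, and bilinearity gives
  $m_k = \langle\nabla_x L_{M_k}(x_k, y_k), x_k - x^*\rangle
    + \langle\nabla_y L_{M_k}(x_k, y_k), \tilde y_k - y_k\rangle$
  for the drifting comparator $\tilde y_k = (\lambda^*, M_k^{-1}\lambda^*)$.
  Replacing the gradients by the stochastic ones splits $\sum_{k<T} m_k$ into the regret of projected
  gradient steps, which is of order $\sqrt T$ because the comparator moves by at most a multiple of
  $1/(k+1)$, and a martingale with bounded increments, to which the Azuma--Hoeffding inequality
  applies. The constant $\kappa_1$ bounds the first part by $T\varepsilon/2$, and $\kappa_2$ the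
  second one with probability at least $1 - \delta$.
\<close>

text \<open>The residual \<alpha> P V* + R - Q* vanishes by the definition of Q*, so L_M(x*, y)
  depends on y only through \<lambda>, and affinely. This is why the gap of the averages is the
  average of the m_k although the averages weight \<mu> by M_k. On the other side, M_k multiplies
  the Bellman terms, and only the multiplier M_k^{-1} \<lambda>* undoes this weight; the price is
  that the comparator moves.

  The constants must not pick up uncontrolled powers of the dimension n = |S||A|. Every pair has
  probability at least \<zeta>, hence n \<zeta> \<le> 1. Put B = \<sigma> / (1 - \<alpha>) and D = B
  / \<zeta>. As the entries of \<eta> sum to \<sigma>, B is the radius of the boxes for Q, V and
  \<lambda>, while D is that of the box for \<mu>, and n B \<le> D. The factor in front of \<kappa>
  is (D n)^4.

  The martingale increments are estimated through m_k and the stochastic gradients, so the exact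
  gradients never have to be bounded.\<close>

section \<open>Regret of projected gradient steps\<close>

lemma sum_inverse_sqrt_le: "(\<Sum>k<T. 1 / sqrt (real (k + 1))) \<le> 2 * sqrt (real T)"
proof (induction T)
  case (Suc T)
  have "1 / sqrt (real (T + 1)) \<le> 2 * (sqrt (real (T + 1)) - sqrt (real T))"
  proof -
    have "(sqrt (real (T + 1)) - sqrt (real T)) * (sqrt (real (T + 1)) + sqrt (real T)) = 1"
      by (simp add: algebra_simps flip: power2_eq_square)
    moreover have "(sqrt (real (T + 1)) - sqrt (real T)) * (sqrt (real (T + 1)) + sqrt (real T))
        \<le> (sqrt (real (T + 1)) - sqrt (real T)) * (2 * sqrt (real (T + 1)))"
      by (intro mult_left_mono) auto
    ultimately show ?thesis
      by (simp add: field_simps)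
  qed
  with Suc show ?case by simp
qed simp

text \<open>Summation by parts. Keeping \<open>a T\<close> in the bound closes the induction: the
  step only asks that the increase of the square root times \<open>a T\<close> is at most the same
  increase times \<open>D\<close>.\<close>

lemma sum_sqrt_weighted_telescope_le:
  fixes a :: "nat \<Rightarrow> real"
  assumes "\<And>k. a k \<le> D"
  shows "(\<Sum>k<T. sqrt (real (k + 1)) * (a k - a (k + 1))) \<le> sqrt (real T) * (D - a T)"
proof (induction T)
  case (Suc T)
  have "(sqrt (real (T + 1)) - sqrt (real T)) * a T \<le> (sqrt (real (T + 1)) - sqrt (real T)) * D"
    using assms by (intro mult_left_mono) auto
  with Suc show ?case by (simp add: algebra_simps)
qed simp

text \<open>Regret against a moving comparator. \<open>D\<close> bounds distances along the run and
  not the diameter of \<open>C\<close>, so \<open>z 0\<close> may lie outside \<open>C\<close>.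
  \<open>E\<close> charges the move from \<open>u k\<close> to \<open>u (Suc k)\<close> after the
  step; its 1 / (k + 1) divided by the step size leaves 1 / sqrt (k + 1), the order of the gradient
  term.\<close>

lemma projected_gradient_regret:
  fixes z u g :: "nat \<Rightarrow> 'v::euclidean_space"
  assumes C: "convex C" "closed C" and u: "\<And>k. u k \<in> C"
    and "0 < \<gamma>0"
    and step: "\<And>k. z (Suc k) = closest_point C (z k - (\<gamma>0 / sqrt (real (k + 1))) *\<^sub>R g k)"
    and D: "\<And>k. (norm (z k - u k))\<^sup>2 \<le> D"
    and G: "\<And>k. (norm (g k))\<^sup>2 \<le> G"
    and E: "\<And>k. (norm (z (Suc k) - u (Suc k)))\<^sup>2 - (norm (z (Suc k) - u k))\<^sup>2 \<le> E / real (k + 1)"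
    and "0 \<le> E"
  shows "(\<Sum>k<T. g k \<bullet> (z k - u k)) \<le> sqrt (real T) * (D / (2 * \<gamma>0) + E / \<gamma>0 + \<gamma>0 * G)"
proof -
  define a where "a k = (norm (z k - u k))\<^sup>2" for k
  have G0: "0 \<le> G" by (rule order_trans[OF _ G]) simp
  have one: "g k \<bullet> (z k - u k) \<le> (1 / (2 * \<gamma>0)) * (sqrt (real (k + 1)) * (a k - a (k + 1)))
      + (E / (2 * \<gamma>0)) * (1 / sqrt (real (k + 1))) + (\<gamma>0 * G / 2) * (1 / sqrt (real (k + 1)))" for k
  proof -
    define w where "w = sqrt (real (k + 1))"
    have w: "0 < w" "real (k + 1) = w * w" unfolding w_def by auto
    define c where "c = \<gamma>0 / w"
    have c: "0 < c" using w \<open>0 < \<gamma>0\<close> by (simp add: c_def)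
    \<comment> \<open>The projection is nonexpansive and fixes \<open>u k\<close>, so it only brings
      the iterate closer.\<close>
    have "dist (closest_point C (z k - c *\<^sub>R g k)) (closest_point C (u k)) \<le> dist (z k - c *\<^sub>R g k) (u k)"
      using C u by (intro closest_point_lipschitz) auto
    moreover have "closest_point C (u k) = u k"
      using u by (rule closest_point_self)
    ultimately have "norm (z (Suc k) - u k) \<le> norm ((z k - u k) - c *\<^sub>R g k)"
      using step[of k] by (simp add: dist_norm c_def w_def algebra_simps)
    hence "(norm (z (Suc k) - u k))\<^sup>2 \<le> (norm ((z k - u k) - c *\<^sub>R g k))\<^sup>2"
      by (intro power_mono) auto
    also have "\<dots> = a k - 2 * c * (g k \<bullet> (z k - u k)) + c\<^sup>2 * (norm (g k))\<^sup>2"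
      unfolding a_def power2_norm_eq_inner by (simp add: algebra_simps inner_commute power2_eq_square)
    also have "\<dots> \<le> a k - 2 * c * (g k \<bullet> (z k - u k)) + c\<^sup>2 * G"
      using G[of k] by (intro add_left_mono mult_left_mono) auto
    finally have "2 * c * (g k \<bullet> (z k - u k)) \<le> a k - a (k + 1) + E / (w * w) + c\<^sup>2 * G"
      using E[of k] unfolding a_def w(2) by simp
    hence "(g k \<bullet> (z k - u k)) \<le> (a k - a (k + 1) + E / (w * w) + c\<^sup>2 * G) / (2 * c)"
      using c by (simp add: pos_le_divide_eq mult_ac)
    also have "\<dots> = (1 / (2 * \<gamma>0)) * (w * (a k - a (k + 1)))
      + (E / (2 * \<gamma>0)) * (1 / w) + (\<gamma>0 * G / 2) * (1 / w)"
      using w(1) \<open>0 < \<gamma>0\<close> unfolding c_def by (simp add: field_simps power2_eq_square)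
    finally show ?thesis unfolding w_def .
  qed
  have a_le: "(\<Sum>k<T. sqrt (real (k + 1)) * (a k - a (k + 1))) \<le> sqrt (real T) * D"
    using sum_sqrt_weighted_telescope_le[of a D T] D
    by (auto simp: a_def right_diff_distrib intro: order_trans)
  have "(\<Sum>k<T. g k \<bullet> (z k - u k)) \<le> (\<Sum>k<T. (1 / (2 * \<gamma>0)) * (sqrt (real (k + 1)) * (a k - a (k + 1)))
      + (E / (2 * \<gamma>0)) * (1 / sqrt (real (k + 1))) + (\<gamma>0 * G / 2) * (1 / sqrt (real (k + 1))))"
    by (intro sum_mono one)
  also have "\<dots> = (1 / (2 * \<gamma>0)) * (\<Sum>k<T. sqrt (real (k + 1)) * (a k - a (k + 1)))
      + (E / (2 * \<gamma>0)) * (\<Sum>k<T. 1 / sqrt (real (k + 1))) + (\<gamma>0 * G / 2) * (\<Sum>k<T. 1 / sqrt (real (k + 1)))"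
    by (simp only: sum.distrib sum_distrib_left)
  also have "\<dots> \<le> (1 / (2 * \<gamma>0)) * (sqrt (real T) * D)
      + (E / (2 * \<gamma>0)) * (2 * sqrt (real T)) + (\<gamma>0 * G / 2) * (2 * sqrt (real T))"
    using \<open>0 < \<gamma>0\<close> \<open>0 \<le> E\<close> G0 a_le sum_inverse_sqrt_le
    by (intro add_mono mult_left_mono) auto
  also have "\<dots> = sqrt (real T) * (D / (2 * \<gamma>0) + E / \<gamma>0 + \<gamma>0 * G)"
    by (simp add: algebra_simps)
  finally show ?thesis .
qed

section \<open>Martingale concentration\<close>

lemma filtration_measurable_mono:
  assumes "filtration \<Omega> F" "i \<le> j" "f \<in> measurable (F i) N"
  shows "f \<in> measurable (F j) N"
  using measurable_mono[OF order_refl refl filtration.sets_F_mono[OF assms(1,2)]] assms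
  by (auto simp: filtration.space_F)

text \<open>Hoeffding's lemma for a fair sign: at p = 1 / 2 and h = 2 x the left side of
  \<open>Hoeffdings_lemma_aux\<close> is ln (cosh x).\<close>

lemma cosh_le_exp_square:
  fixes x :: real
  assumes "0 \<le> x"
  shows "(exp x + exp (- x)) / 2 \<le> exp (x\<^sup>2 / 2)"
proof -
  have pos: "0 < exp x + exp (- x)"
    by (intro add_pos_pos) auto
  have e1: "1 + 1 / 2 * (exp (2 * x) - 1) = exp x * ((exp x + exp (- x)) / 2)"
    by (simp add: field_simps flip: exp_add)
  have e2: "ln (exp x * ((exp x + exp (- x)) / 2)) = x + ln ((exp x + exp (- x)) / 2)"
    using pos by (subst ln_mult) auto
  have "- (2 * x) * (1 / 2) + ln (1 + 1 / 2 * (exp (2 * x) - 1)) \<le> (2 * x)\<^sup>2 / 8"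
    using assms by (intro Hoeffdings_lemma_aux) auto
  hence "ln ((exp x + exp (- x)) / 2) \<le> x\<^sup>2 / 2"
    unfolding e1 e2 by (simp add: power2_eq_square)
  hence "exp (ln ((exp x + exp (- x)) / 2)) \<le> exp (x\<^sup>2 / 2)"
    by (simp only: exp_le_cancel_iff)
  thus ?thesis
    using pos by simp
qed

text \<open>Convexity of exp on the segment from -c to c. The bound is affine in \<open>d\<close>,
  so its second term averages out for a martingale difference.\<close>

lemma exp_le_chord:
  fixes d c s :: real
  assumes "\<bar>d\<bar> \<le> c" "0 < c" "0 \<le> s"
  shows "exp (s * d) \<le> (exp (s * c) + exp (- (s * c))) / 2 + d * ((exp (s * c) - exp (- (s * c))) / (2 * c))"
proof -
  define t where "t = (c + d) / (2 * c)"
  have t: "0 \<le> t" "t \<le> 1" using assms by (auto simp: t_def field_simps)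
  have "exp (s * ((1 - t) *\<^sub>R (-c) + t *\<^sub>R c)) \<le> (1 - t) * exp (s * (-c)) + t * exp (s * c)"
    using convex_onD[OF convex_on_exp[OF assms(3)] t, of "-c" c] by simp
  also have "(1 - t) *\<^sub>R (-c) + t *\<^sub>R c = d"
    using \<open>0 < c\<close> by (simp add: t_def field_simps)
  also have "(1 - t) * exp (s * (-c)) + t * exp (s * c)
      = (exp (s * c) + exp (- (s * c))) / 2 + d * ((exp (s * c) - exp (- (s * c))) / (2 * c))"
    using \<open>0 < c\<close> by (simp add: t_def field_simps)
  finally show ?thesis .
qed

text \<open>Multiplied by the past factor \<open>f\<close>, the chord bound has a linear term with
  expectation zero, because \<open>f\<close> is known at time n. Each step thus costs one factor
  cosh (s c), without conditional moment generating functions. Integrability is part of the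
  induction because the next step needs it for \<open>f\<close>.\<close>

lemma (in prob_space) azuma_hoeffding_mgf:
  fixes d :: "nat \<Rightarrow> 'a \<Rightarrow> real"
  assumes F: "filtration (space M) F" "\<And>k. subalgebra M (F k)"
    and meas: "\<And>k. d k \<in> borel_measurable (F (Suc k))"
    and bound: "\<And>k. AE \<omega> in M. \<bar>d k \<omega>\<bar> \<le> c"
    and mean: "\<And>k. AE \<omega> in M. real_cond_exp M (F k) (d k) \<omega> = 0"
    and "0 < c" "0 \<le> s"
  shows "integrable M (\<lambda>\<omega>. exp (s * (\<Sum>k<n. d k \<omega>)))
       \<and> expectation (\<lambda>\<omega>. exp (s * (\<Sum>k<n. d k \<omega>))) \<le> exp (real n * (s * c)\<^sup>2 / 2)"
proof (induction n)
  case 0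
  show ?case by (simp add: prob_space)
next
  case (Suc n)
  define f where "f \<omega> = exp (s * (\<Sum>k<n. d k \<omega>))" for \<omega>
  define C where "C = (exp (s * c) + exp (- (s * c))) / 2"
  define K where "K = (exp (s * c) - exp (- (s * c))) / (2 * c)"
  interpret fn: finite_measure_subalgebra M "F n"
    using F(2) by unfold_locales
  have dF: "d k \<in> borel_measurable (F n)" if "k < n" for k
    using filtration_measurable_mono[OF F(1) _ meas] that by simp
  have fF [measurable]: "f \<in> borel_measurable (F n)"
    unfolding f_def[abs_def] using dF
    by (intro measurable_compose[OF _ borel_measurable_exp] borel_measurable_times
        borel_measurable_sum borel_measurable_const) auto
  have dM [measurable]: "d k \<in> borel_measurable M" for k
    by (rule measurable_from_subalg[OF F(2) meas])
  have fM [measurable]: "f \<in> borel_measurable M"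
    by (rule measurable_from_subalg[OF F(2) fF])
  have intf: "integrable M f" and Ef: "expectation f \<le> exp (real n * (s * c)\<^sup>2 / 2)"
    using Suc by (auto simp: f_def[abs_def])
  have intfd: "integrable M (\<lambda>\<omega>. f \<omega> * d n \<omega>)"
  proof (rule Bochner_Integration.integrable_bound[of M "\<lambda>\<omega>. c * f \<omega>"])
    show "AE \<omega> in M. norm (f \<omega> * d n \<omega>) \<le> norm (c * f \<omega>)"
      using bound[of n] by eventually_elim (use \<open>0 < c\<close> in \<open>auto simp: f_def abs_mult\<close>)
  qed (use intf in auto)
  have "expectation (\<lambda>\<omega>. f \<omega> * d n \<omega>) = expectation (\<lambda>\<omega>. f \<omega> * real_cond_exp M (F n) (d n) \<omega>)"
    by (rule fn.real_cond_exp_intg(2)[symmetric]) (use intfd in auto)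
  also have "\<dots> = expectation (\<lambda>\<omega>. 0)"
    by (rule integral_cong_AE) (use mean[of n] in auto)
  finally have E0: "expectation (\<lambda>\<omega>. f \<omega> * d n \<omega>) = 0" by simp
  have split: "exp (s * (\<Sum>k<Suc n. d k \<omega>)) = f \<omega> * exp (s * d n \<omega>)" for \<omega>
    by (simp add: f_def distrib_left exp_add)
  have chord: "AE \<omega> in M. f \<omega> * exp (s * d n \<omega>) \<le> C * f \<omega> + K * (f \<omega> * d n \<omega>)"
    using bound[of n]
  proof eventually_elim
    case (elim \<omega>)
    have "f \<omega> * exp (s * d n \<omega>) \<le> f \<omega> * (C + d n \<omega> * K)"
      using exp_le_chord[OF elim \<open>0 < c\<close> \<open>0 \<le> s\<close>] unfolding C_def K_def f_def by (intro mult_left_mono) auto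
    thus ?case by (simp add: algebra_simps)
  qed
  have intr: "integrable M (\<lambda>\<omega>. C * f \<omega> + K * (f \<omega> * d n \<omega>))"
    using intf intfd by auto
  have intl: "integrable M (\<lambda>\<omega>. f \<omega> * exp (s * d n \<omega>))"
  proof (rule Bochner_Integration.integrable_bound[OF intr])
    show "AE \<omega> in M. norm (f \<omega> * exp (s * d n \<omega>)) \<le> norm (C * f \<omega> + K * (f \<omega> * d n \<omega>))"
      using chord
    proof eventually_elim
      case (elim \<omega>)
      moreover have "0 \<le> f \<omega> * exp (s * d n \<omega>)" by (simp add: f_def)
      ultimately show ?case by simp
    qed
  qed measurable
  have "expectation (\<lambda>\<omega>. f \<omega> * exp (s * d n \<omega>)) \<le> expectation (\<lambda>\<omega>. C * f \<omega> + K * (f \<omega> * d n \<omega>))"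
    by (rule integral_mono_AE[OF intl intr chord])
  also have "\<dots> = C * expectation f"
    using intf intfd E0 by simp
  also have "\<dots> \<le> exp ((s * c)\<^sup>2 / 2) * exp (real n * (s * c)\<^sup>2 / 2)"
    using cosh_le_exp_square[of "s * c"] \<open>0 < c\<close> \<open>0 \<le> s\<close> Ef unfolding C_def
    by (intro mult_mono) (auto simp: f_def)
  also have "\<dots> = exp (real (Suc n) * (s * c)\<^sup>2 / 2)"
    by (simp add: field_simps flip: exp_add)
  finally show ?case
    using intl by (simp only: split) 
qed

lemma (in prob_space) azuma_hoeffding:
  fixes d :: "nat \<Rightarrow> 'a \<Rightarrow> real"
  assumes F: "filtration (space M) F" "\<And>k. subalgebra M (F k)"
    and meas: "\<And>k. d k \<in> borel_measurable (F (Suc k))"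
    and bound: "\<And>k. AE \<omega> in M. \<bar>d k \<omega>\<bar> \<le> c"
    and mean: "\<And>k. AE \<omega> in M. real_cond_exp M (F k) (d k) \<omega> = 0"
    and "0 < c" "0 < t" "0 < n"
  shows "prob {\<omega> \<in> space M. t \<le> (\<Sum>k<n. d k \<omega>)} \<le> exp (- (t\<^sup>2 / (2 * real n * c\<^sup>2)))"
proof -
  \<comment> \<open>This \<open>s\<close> minimises n (s c)^2 / 2 - s t, the exponent left by
    Markov's inequality.\<close>
  define s where "s = t / (real n * c\<^sup>2)"
  have s: "0 < s" using assms by (simp add: s_def)
  note mgf = azuma_hoeffding_mgf[OF F meas bound mean \<open>0 < c\<close> less_imp_le[OF s], of n]
  have [measurable]: "d k \<in> borel_measurable M" for k
    by (rule measurable_from_subalg[OF F(2) meas])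
  have "prob {\<omega> \<in> space M. t \<le> (\<Sum>k<n. d k \<omega>)}
      = prob {\<omega> \<in> space M. exp (s * t) \<le> exp (s * (\<Sum>k<n. d k \<omega>))}"
    using s by simp
  also have "\<dots> \<le> expectation (\<lambda>\<omega>. exp (s * (\<Sum>k<n. d k \<omega>))) / exp (s * t)"
    by (rule integral_Markov_inequality_measure[where A = "{}"]) (use mgf in auto)
  also have "\<dots> \<le> exp (real n * (s * c)\<^sup>2 / 2) / exp (s * t)"
    using mgf by (intro divide_right_mono) auto
  also have "\<dots> = exp (real n * (s * c)\<^sup>2 / 2 - s * t)"
    by (simp add: exp_diff)
  also have "real n * (s * c)\<^sup>2 / 2 - s * t = - (t\<^sup>2 / (2 * real n * c\<^sup>2))"
    using \<open>0 < c\<close> \<open>0 < n\<close> by (simp add: s_def power2_eq_square field_simps)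
  finally show ?thesis .
qed

text \<open>Coordinatewise, \<open>p\<close> is bounded and known to \<open>G\<close>, so it can be
  pulled out of the conditional expectation.\<close>

lemma cond_mean_zero_inner:
  fixes Z p :: "'w \<Rightarrow> 'v::euclidean_space"
  assumes "finite_measure_subalgebra W G" "cond_mean_zero W G Z"
    and p: "p \<in> borel_measurable G" "\<And>\<omega>. \<omega> \<in> space W \<Longrightarrow> norm (p \<omega>) \<le> c"
  shows "integrable W (\<lambda>\<omega>. Z \<omega> \<bullet> p \<omega>)"
    and "AE \<omega> in W. real_cond_exp W G (\<lambda>\<omega>. Z \<omega> \<bullet> p \<omega>) \<omega> = 0"
proof -
  interpret finite_measure_subalgebra W G by fact
  \<comment> \<open>Extension by zero outside \<open>Basis\<close>: the sum rule for conditional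
    expectations asks for integrability at every index.\<close>
  define f where "f b \<omega> = (if b \<in> Basis then (p \<omega> \<bullet> b) * (Z \<omega> \<bullet> b) else 0)" for b \<omega>
  have pb: "(\<lambda>\<omega>. p \<omega> \<bullet> b) \<in> borel_measurable G" for b
    using p(1) by (intro borel_measurable_inner) auto
  have Zb: "integrable W (\<lambda>\<omega>. Z \<omega> \<bullet> b)" "AE \<omega> in W. real_cond_exp W G (\<lambda>\<omega>. Z \<omega> \<bullet> b) \<omega> = 0"
    if "b \<in> Basis" for b
    using assms(2) that by (auto simp: cond_mean_zero_def)
  have prod: "integrable W (\<lambda>\<omega>. (p \<omega> \<bullet> b) * (Z \<omega> \<bullet> b))" if b: "b \<in> Basis" for b
  proof (rule Bochner_Integration.integrable_bound[of W "\<lambda>\<omega>. c * (Z \<omega> \<bullet> b)"])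
    show "AE \<omega> in W. norm ((p \<omega> \<bullet> b) * (Z \<omega> \<bullet> b)) \<le> norm (c * (Z \<omega> \<bullet> b))"
    proof (rule AE_I2)
      fix \<omega> assume "\<omega> \<in> space W"
      hence "\<bar>p \<omega> \<bullet> b\<bar> \<le> \<bar>c\<bar>"
        using p(2) Basis_le_norm[OF b, of "p \<omega>"] by fastforce
      thus "norm ((p \<omega> \<bullet> b) * (Z \<omega> \<bullet> b)) \<le> norm (c * (Z \<omega> \<bullet> b))"
        by (simp add: abs_mult mult_right_mono)
    qed
    show "(\<lambda>\<omega>. (p \<omega> \<bullet> b) * (Z \<omega> \<bullet> b)) \<in> borel_measurable W"
      using measurable_from_subalg[OF subalg pb] Zb(1)[OF b] by (intro borel_measurable_times) auto
  qed (use Zb(1)[OF b] in auto)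
  have f: "integrable W (f b)" for b
    using prod by (cases "b \<in> Basis") (auto simp: f_def[abs_def])
  have f0: "AE \<omega> in W. real_cond_exp W G (f b) \<omega> = 0" if b: "b \<in> Basis" for b
  proof -
    have "AE \<omega> in W. real_cond_exp W G (\<lambda>\<omega>. (p \<omega> \<bullet> b) * (Z \<omega> \<bullet> b)) \<omega>
        = (p \<omega> \<bullet> b) * real_cond_exp W G (\<lambda>\<omega>. Z \<omega> \<bullet> b) \<omega>"
      using Zb(1)[OF b] by (intro real_cond_exp_mult pb prod b) auto
    thus ?thesis
      using Zb(2)[OF b] b by (auto simp: f_def[abs_def])
  qed
  have eq: "(\<lambda>\<omega>. Z \<omega> \<bullet> p \<omega>) = (\<lambda>\<omega>. \<Sum>b\<in>Basis. f b \<omega>)"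
    by (rule ext, subst euclidean_inner) (simp add: f_def mult.commute)
  show "integrable W (\<lambda>\<omega>. Z \<omega> \<bullet> p \<omega>)"
    unfolding eq using f by auto
  have "AE \<omega> in W. \<forall>b\<in>Basis. real_cond_exp W G (f b) \<omega> = 0"
    using f0 by (intro AE_finite_allI) auto
  moreover have "AE \<omega> in W. real_cond_exp W G (\<lambda>\<omega>. \<Sum>b\<in>Basis. f b \<omega>) \<omega>
      = (\<Sum>b\<in>Basis. real_cond_exp W G (f b) \<omega>)"
    using f by (rule real_cond_exp_sum)
  ultimately show "AE \<omega> in W. real_cond_exp W G (\<lambda>\<omega>. Z \<omega> \<bullet> p \<omega>) \<omega> = 0"
    unfolding eq by eventually_elim simp
qed

section \<open>The constraint sets and the Lagrangian\<close>

text \<open>The Riesz vector \<open>D\<close> of the linear part is a gradient, and uniqueness of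
  derivatives makes it the value of the definite description in \<open>grad\<close>.\<close>

lemma grad_affine:
  fixes f :: "'v::euclidean_space \<Rightarrow> real"
  assumes "linear (\<lambda>z. f z - f 0)"
  shows "grad f z \<bullet> (a - b) = f a - f b"
proof -
  define l where "l z = f z - f 0" for z
  have l: "linear l" using assms unfolding l_def[abs_def] .
  define D where "D = (\<Sum>b\<in>Basis. l b *\<^sub>R b)"
  have lD: "l h = h \<bullet> D" for h
  proof -
    have "l h = l (\<Sum>b\<in>Basis. (h \<bullet> b) *\<^sub>R b)" by (simp add: euclidean_representation)
    also have "\<dots> = h \<bullet> D"
      using l by (simp add: linear_sum linear_cmul D_def inner_sum_right mult.commute)
    finally show ?thesis .
  qed
  define c where "c = f 0"
  have f: "f = (\<lambda>z. z \<bullet> D + c)"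
  proof
    fix z show "f z = z \<bullet> D + c"
      using lD[of z] unfolding l_def c_def by linarith
  qed
  have der: "(f has_derivative (\<lambda>h. h \<bullet> D)) (at z)"
    unfolding f by (auto intro!: derivative_eq_intros)
  have "grad f z = D"
    unfolding grad_def gderiv_def
  proof (rule the_equality)
    fix E assume "(f has_derivative (\<lambda>h. h \<bullet> E)) (at z)"
    from has_derivative_unique[OF this der] have "h \<bullet> E = h \<bullet> D" for h by metis
    thus "E = D" by (metis inner_commute vector_eq_rdot)
  qed (rule der)
  thus ?thesis
    using f by (simp add: inner_diff_right inner_commute)
qed

lemma nonneg_box_eq_cbox: "nonneg_box c = cbox 0 (\<chi> i. c)"
proof -
  have *: "infnorm v \<le> c \<longleftrightarrow> (\<forall>i. v $ i \<le> c)" if "\<forall>i. 0 \<le> v $ i" for v :: "real ^ 'n"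
  proof
    assume "infnorm v \<le> c"
    thus "\<forall>i. v $ i \<le> c"
      using component_le_infnorm_cart[of v] by (meson abs_ge_self order_trans)
  next
    assume "\<forall>i. v $ i \<le> c"
    thus "infnorm v \<le> c"
      using that unfolding infnorm_cart by (intro cSup_least) auto
  qed
  thus ?thesis
    unfolding nonneg_box_def set_eq_iff mem_box_cart mem_Collect_eq
    by (metis (no_types, lifting) vec_lambda_beta zero_index)
qed

lemma mem_nonneg_box: "v \<in> nonneg_box c \<longleftrightarrow> (\<forall>i. 0 \<le> v $ i \<and> v $ i \<le> c)"
  by (simp add: nonneg_box_eq_cbox mem_box_cart)

lemma X_set_eq: "X_set \<alpha> \<sigma> = nonneg_box (\<sigma> / (1 - \<alpha>)) \<times> nonneg_box (\<sigma> / (1 - \<alpha>))"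
  by (auto simp: X_set_def V_set_def mem_nonneg_box)

lemma convex_nonneg_box: "convex (nonneg_box c)"
  and closed_nonneg_box: "closed (nonneg_box c)"
  unfolding nonneg_box_eq_cbox by (rule convex_box, rule closed_cbox)

lemma convex_Xi_set: "convex (Xi_set \<eta> :: (real ^ ('s::finite \<times> 'a::finite)) set)"
proof -
  have eq: "(Xi_set \<eta> :: (real ^ ('s \<times> 'a)) set) = (\<Inter>s. {l. \<eta> $ s \<le> (\<Sum>a\<in>UNIV. axis (s, a) 1) \<bullet> l})"
    by (auto simp: Xi_set_def inner_sum_left inner_axis')
  show ?thesis
    unfolding eq by (intro convex_INT convex_halfspace_ge)
qed

lemma closed_Xi_set: "closed (Xi_set \<eta>)"
  unfolding Xi_set_def by (intro closed_Collect_all closed_Collect_le continuous_intros)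

lemma convex_X_set: "convex (X_set \<alpha> \<sigma>)"
  and closed_X_set: "closed (X_set \<alpha> \<sigma>)"
  by (auto simp: X_set_eq convex_nonneg_box closed_nonneg_box intro!: convex_Times closed_Times)

lemma convex_Y_set: "convex (Y_set \<alpha> \<zeta> \<eta>)"
  and closed_Y_set: "closed (Y_set \<alpha> \<zeta> \<eta>)"
  by (auto simp: Y_set_def L_set_def M_set_def convex_nonneg_box closed_nonneg_box convex_Xi_set
      closed_Xi_set intro!: convex_Times closed_Times convex_Int closed_Int)

lemma dist_matrix_vector: "dist_matrix \<tau> *v w = (\<chi> i. \<tau> (fst i) (snd i) * w $ i)"
  by (simp add: vec_eq_iff dist_matrix_def matrix_vector_mult_def if_distrib if_distribR cong: if_cong)

text \<open>\<open>matrix_inv\<close> chooses some two-sided inverse; exhibiting one shows that the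
  choice succeeds, and inverses are unique.\<close>

lemma matrix_inv_dist_matrix:
  assumes "\<And>s a. \<tau> s a \<noteq> 0"
  shows "matrix_inv (dist_matrix \<tau>) = dist_matrix (\<lambda>s a. inverse (\<tau> s a))"
proof -
  let ?A = "dist_matrix \<tau>" and ?B = "dist_matrix (\<lambda>s a. inverse (\<tau> s a))"
  have 1: "?A ** ?B = mat 1" "?B ** ?A = mat 1"
    using assms by (auto simp: matrix_eq dist_matrix_vector vec_eq_iff simp flip: matrix_vector_mul_assoc)
  hence 2: "?A ** matrix_inv ?A = mat 1"
    unfolding matrix_inv_def by (rule someI2[where a = ?B, OF conjI]) simp
  have "matrix_inv ?A = (?B ** ?A) ** matrix_inv ?A"
    by (simp only: 1 matrix_mul_lid)
  also have "\<dots> = ?B"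
    by (simp only: 2 matrix_mul_rid flip: matrix_mul_assoc)
  finally show ?thesis .
qed

lemma row_stochastic_average_bounds:
  assumes "row_stochastic A" "\<And>j. 0 \<le> f j" "\<And>j. f j \<le> (b::real)"
  shows "0 \<le> (\<Sum>j\<in>UNIV. A $ i $ j * f j) \<and> (\<Sum>j\<in>UNIV. A $ i $ j * f j) \<le> b"
proof -
  have "(\<Sum>j\<in>UNIV. A $ i $ j * f j) \<le> (\<Sum>j\<in>UNIV. A $ i $ j * b)"
    using assms by (intro sum_mono mult_left_mono) (auto simp: row_stochastic_def)
  also have "\<dots> = b"
    using assms by (simp add: row_stochastic_def flip: sum_distrib_right)
  finally show ?thesis
    using assms by (auto simp: row_stochastic_def intro!: sum_nonneg)
qed

lemma expected_reward_bounds: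
  assumes P: "\<And>a. row_stochastic (P a)" and R: "\<And>i. 0 \<le> R $ i" "\<And>i. R $ i \<le> \<sigma>"
  shows "0 \<le> expected_reward P R \<pi> t s \<and> expected_reward P R \<pi> t s \<le> \<sigma>"
proof (induction t arbitrary: s)
  case (Suc t)
  show ?case
    using row_stochastic_average_bounds[OF P, of "expected_reward P R \<pi> t" \<sigma>] Suc by simp
qed (use R in auto)

text \<open>Every policy value is dominated by a geometric series, and the maximum over finitely
  many policies is attained.\<close>

lemma optimal_V_bounds:
  assumes "\<And>a. row_stochastic (P a)" "\<And>i. 0 \<le> R $ i" "\<And>i. R $ i \<le> \<sigma>" and \<alpha>: "0 \<le> \<alpha>" "\<alpha> < 1"
  shows "0 \<le> optimal_V \<alpha> P R $ s \<and> optimal_V \<alpha> P R $ s \<le> \<sigma> / (1 - \<alpha>)"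
proof -
  note r = expected_reward_bounds[of P R \<sigma>, OF assms(1-3)]
  have "0 \<le> policy_value \<alpha> P R \<pi> s \<and> policy_value \<alpha> P R \<pi> s \<le> \<sigma> / (1 - \<alpha>)" for \<pi>
  proof -
    have le: "\<alpha> ^ t * expected_reward P R \<pi> t s \<le> \<alpha> ^ t * \<sigma>" for t
      using r \<alpha> by (intro mult_left_mono) auto
    have geo: "(\<lambda>t. \<alpha> ^ t * \<sigma>) sums (1 / (1 - \<alpha>) * \<sigma>)"
      using \<alpha> by (intro sums_mult2 geometric_sums) auto
    have smb: "summable (\<lambda>t. \<alpha> ^ t * expected_reward P R \<pi> t s)"
      using le \<alpha> r by (intro summable_comparison_test'[OF sums_summable[OF geo], of 0]) auto
    have "policy_value \<alpha> P R \<pi> s \<le> (\<Sum>t. \<alpha> ^ t * \<sigma>)"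
      unfolding policy_value_def using le smb sums_summable[OF geo] by (intro suminf_le) auto
    moreover have "0 \<le> policy_value \<alpha> P R \<pi> s"
      unfolding policy_value_def using smb r \<alpha> by (intro suminf_nonneg) auto
    ultimately show ?thesis
      using sums_unique[OF geo] by simp
  qed
  moreover have "optimal_V \<alpha> P R $ s \<in> range (\<lambda>\<pi>. policy_value \<alpha> P R \<pi> s)"
    unfolding optimal_V_def vec_lambda_beta by (intro Max_in) auto
  ultimately show ?thesis
    by auto
qed

lemma stacked_P_vector: "(stacked_P P *v V) $ i = (\<Sum>s'\<in>UNIV. P (snd i) $ fst i $ s' * V $ s')"
  by (simp add: stacked_P_def matrix_vector_mult_def)

lemma stacked_I_vector: "(stacked_I *v V) $ i = V $ fst i"
  by (simp add: stacked_I_def matrix_vector_mult_def if_distribR if_distrib cong: if_cong)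

lemma optimal_Q_bounds:
  assumes P: "\<And>a. row_stochastic (P a)" and R: "\<And>i. 0 \<le> R $ i" "\<And>i. R $ i \<le> \<sigma>" and \<alpha>: "0 \<le> \<alpha>" "\<alpha> < 1"
  shows "0 \<le> optimal_Q \<alpha> P R $ i \<and> optimal_Q \<alpha> P R $ i \<le> \<sigma> / (1 - \<alpha>)"
proof -
  have b: "0 \<le> (stacked_P P *v optimal_V \<alpha> P R) $ i"
    "(stacked_P P *v optimal_V \<alpha> P R) $ i \<le> \<sigma> / (1 - \<alpha>)"
    using row_stochastic_average_bounds[OF P, of "\<lambda>s. optimal_V \<alpha> P R $ s" "\<sigma> / (1 - \<alpha>)" "snd i" "fst i"]
      optimal_V_bounds[OF assms] by (auto simp: stacked_P_vector)
  have "R $ i + \<alpha> * (stacked_P P *v optimal_V \<alpha> P R) $ i \<le> \<sigma> + \<alpha> * (\<sigma> / (1 - \<alpha>))"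
    using b R \<alpha> by (intro add_mono mult_left_mono) auto
  also have "\<dots> = \<sigma> / (1 - \<alpha>)" using \<alpha> by (simp add: field_simps)
  finally show ?thesis
    using b R[of i] \<alpha> by (simp add: optimal_Q_def)
qed

lemma sum_UNIV_Times: "(\<Sum>i\<in>UNIV. f i) = (\<Sum>s\<in>UNIV. \<Sum>a\<in>UNIV. f (s, a))"
  by (simp add: sum.cartesian_product flip: UNIV_Times_UNIV)

lemma transpose_stacked_I_vector: "(l v* stacked_I) $ s = (\<Sum>a\<in>UNIV. l $ (s, a))"
proof -
  have "(l v* stacked_I) $ s = (\<Sum>s'\<in>UNIV. \<Sum>a\<in>UNIV. if s' = s then l $ (s', a) else 0)"
    by (simp add: vector_matrix_mult_def stacked_I_def sum_UNIV_Times if_distrib if_distribR cong: if_cong)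
  also have "\<dots> = (\<Sum>s'\<in>UNIV. if s' = s then (\<Sum>a\<in>UNIV. l $ (s', a)) else 0)"
    by (intro sum.cong) auto
  finally show ?thesis by simp
qed

lemma dual_feasible_mem_Xi_set:
  assumes "dual_feasible \<alpha> \<eta> P l" "\<And>a. row_stochastic (P a)" "0 \<le> \<alpha>"
  shows "l \<in> Xi_set \<eta>"
proof -
  have "\<eta> $ s + \<alpha> * (l v* stacked_P P) $ s = (\<Sum>a\<in>UNIV. l $ (s, a))" for s
    using assms(1) by (auto simp: dual_feasible_def vec_eq_iff transpose_stacked_I_vector)
  moreover have "0 \<le> (l v* stacked_P P) $ s" for s
    using assms(1,2) by (auto simp: vector_matrix_mult_def stacked_P_def dual_feasible_def row_stochastic_def
        intro!: sum_nonneg)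
  ultimately have "\<eta> $ s \<le> (\<Sum>a\<in>UNIV. l $ (s, a))" for s
    using \<open>0 \<le> \<alpha>\<close> by (metis le_add_same_cancel1 mult_nonneg_nonneg)
  thus ?thesis
    by (simp add: Xi_set_def)
qed

text \<open>Summing the constraint over the states, the total mass m satisfies m = (sum of \<eta>) +
  \<alpha> m, because the rows of each \<open>P a\<close> sum to one. This controls the l1 norm of
  \<lambda>*.\<close>

lemma dual_feasible_sum:
  assumes "dual_feasible \<alpha> \<eta> P l" "\<And>a. row_stochastic (P a)" "\<alpha> < 1"
  shows "(\<Sum>i\<in>UNIV. l $ i) = (\<Sum>s\<in>UNIV. \<eta> $ s) / (1 - \<alpha>)"
proof -
  have eq: "\<eta> $ s + \<alpha> * (l v* stacked_P P) $ s = (\<Sum>a\<in>UNIV. l $ (s, a))" for s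
    using assms(1) by (auto simp: dual_feasible_def vec_eq_iff transpose_stacked_I_vector)
  hence "(\<Sum>i\<in>UNIV. l $ i) = (\<Sum>s\<in>UNIV. \<eta> $ s) + \<alpha> * (\<Sum>s\<in>UNIV. (l v* stacked_P P) $ s)"
    by (subst sum_UNIV_Times) (simp add: sum.distrib sum_distrib_left flip: eq)
  also have "(\<Sum>s\<in>UNIV. (l v* stacked_P P) $ s) = (\<Sum>i\<in>UNIV. l $ i * (\<Sum>s\<in>UNIV. stacked_P P $ i $ s))"
    unfolding vector_matrix_mult_def by (simp add: sum_distrib_left mult.commute) (rule sum.swap)
  also have "\<dots> = (\<Sum>i\<in>UNIV. l $ i)"
    using assms(2) by (simp add: stacked_P_def row_stochastic_def)
  finally show ?thesis
    using \<open>\<alpha> < 1\<close> by (simp add: field_simps)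
qed

text \<open>The dual constraint says that the coefficient of V is zero, and the hypothesis on
  \<open>m\<close> cancels the terms in Q. It covers both \<open>m = l\<close> with the identity
  matrix and the weighted comparator.\<close>

lemma lagrangian_dual_feasible:
  assumes "dual_feasible \<alpha> \<eta> P l" and m: "\<And>w. m \<bullet> (M *v w) = l \<bullet> w"
  shows "lagrangian \<alpha> \<eta> P R M x (l, m) = l \<bullet> R"
proof -
  obtain Q V where x: "x = (Q, V)" by (cases x)
  have "\<eta> = l v* stacked_I - \<alpha> *\<^sub>R (l v* stacked_P P)"
    using assms(1) by (auto simp: dual_feasible_def algebra_simps)
  hence "\<eta> \<bullet> V = l \<bullet> (stacked_I *v V) - \<alpha> * (l \<bullet> (stacked_P P *v V))"
    by (simp add: inner_diff_left dot_lmul_matrix)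
  thus ?thesis
    by (simp add: lagrangian_def x m inner_diff_right inner_add_right)
qed

text \<open>The vector paired with \<open>m\<close> is the Bellman residual, which is zero at this
  point.\<close>

lemma lagrangian_optimal_x:
  "lagrangian \<alpha> \<eta> P R M (optimal_Q \<alpha> P R, optimal_V \<alpha> P R) (l, m)
    = \<eta> \<bullet> optimal_V \<alpha> P R + l \<bullet> (optimal_Q \<alpha> P R - stacked_I *v optimal_V \<alpha> P R)"
  by (simp add: lagrangian_def optimal_Q_def)

text \<open>Affinity in each argument makes first-order differences exact, so the decomposition of
  the gap is an equality.\<close>

lemma grad_lagrangian_x:
  "grad (\<lambda>z. lagrangian \<alpha> \<eta> P R M z y) x \<bullet> (a - b)
    = lagrangian \<alpha> \<eta> P R M a y - lagrangian \<alpha> \<eta> P R M b y"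
proof (rule grad_affine, rule linearI)
  fix b1 b2 :: "('a, 'b) primal" and c :: real
  show "lagrangian \<alpha> \<eta> P R M (b1 + b2) y - lagrangian \<alpha> \<eta> P R M 0 y =
      lagrangian \<alpha> \<eta> P R M b1 y - lagrangian \<alpha> \<eta> P R M 0 y +
      (lagrangian \<alpha> \<eta> P R M b2 y - lagrangian \<alpha> \<eta> P R M 0 y)"
    by (cases b1; cases b2; cases y) (simp add: lagrangian_def zero_prod_def algebra_simps
        matrix_vector_mult_scaleR)
  show "lagrangian \<alpha> \<eta> P R M (c *\<^sub>R b1) y - lagrangian \<alpha> \<eta> P R M 0 y =
      c *\<^sub>R (lagrangian \<alpha> \<eta> P R M b1 y - lagrangian \<alpha> \<eta> P R M 0 y)"
    by (cases b1; cases y) (simp add: lagrangian_def zero_prod_def algebra_simps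
        matrix_vector_mult_scaleR)
qed

lemma grad_lagrangian_y:
  "grad (\<lambda>z. lagrangian \<alpha> \<eta> P R M x z) y \<bullet> (a - b)
    = lagrangian \<alpha> \<eta> P R M x a - lagrangian \<alpha> \<eta> P R M x b"
proof (rule grad_affine, rule linearI)
  fix b1 b2 :: "('a, 'b) dual" and c :: real
  show "lagrangian \<alpha> \<eta> P R M x (b1 + b2) - lagrangian \<alpha> \<eta> P R M x 0 =
      lagrangian \<alpha> \<eta> P R M x b1 - lagrangian \<alpha> \<eta> P R M x 0 +
      (lagrangian \<alpha> \<eta> P R M x b2 - lagrangian \<alpha> \<eta> P R M x 0)"
    by (cases b1; cases b2; cases x) (simp add: lagrangian_def zero_prod_def inner_add_left)
  show "lagrangian \<alpha> \<eta> P R M x (c *\<^sub>R b1) - lagrangian \<alpha> \<eta> P R M x 0 =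
      c *\<^sub>R (lagrangian \<alpha> \<eta> P R M x b1 - lagrangian \<alpha> \<eta> P R M x 0)"
    by (cases b1; cases x) (simp add: lagrangian_def zero_prod_def algebra_simps)
qed

section \<open>Bounds for the stochastic gradients\<close>

lemma borel_measurable_closest_point:
  fixes C :: "'v::euclidean_space set"
  assumes "convex C" "closed C" "C \<noteq> {}"
  shows "closest_point C \<in> borel_measurable borel"
  using assms by (intro borel_measurable_continuous_onI continuous_on_closest_point)

lemma norm_Pair_square: "(norm (a, b))\<^sup>2 = (norm a)\<^sup>2 + (norm b)\<^sup>2"
  by (simp add: norm_Pair)

lemma norm_diff_axis_le: "norm (c *\<^sub>R axis i (1::real) - d *\<^sub>R axis j 1) \<le> \<bar>c\<bar> + \<bar>d\<bar>"
  by (rule order_trans[OF norm_triangle_ineq4]) simp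

lemma norm_nonneg_box_diff_le:
  fixes u v :: "real ^ 'n::finite"
  assumes "u \<in> nonneg_box c" "v \<in> nonneg_box c"
  shows "(norm (u - v))\<^sup>2 \<le> real CARD('n) * c\<^sup>2"
proof -
  have "(norm (u - v))\<^sup>2 = (\<Sum>i\<in>UNIV. ((u - v) $ i)\<^sup>2)"
    unfolding power2_norm_eq_inner inner_vec_def by (simp add: power2_eq_square)
  also have "\<dots> \<le> (\<Sum>i\<in>(UNIV::'n set). c\<^sup>2)"
  proof (rule sum_mono)
    fix i
    have "\<bar>(u - v) $ i\<bar> \<le> \<bar>c\<bar>"
      using assms[unfolded mem_nonneg_box, THEN spec, of i] by auto
    thus "((u - v) $ i)\<^sup>2 \<le> c\<^sup>2"
      by (simp only: abs_le_square_iff)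
  qed
  finally show ?thesis by simp
qed

text \<open>The norm bound feeds the regret estimate, the inner product bound the martingale
  increments.\<close>

lemma gx_bounds:
  fixes l m :: "real ^ ('s::finite \<times> 'a::finite)"
  assumes l: "l \<in> nonneg_box B" and m: "m \<in> nonneg_box D"
    and \<eta>: "0 \<le> real CARD('s) * \<eta> $ sh" "real CARD('s) * \<eta> $ sh \<le> D"
    and n: "real CARD('s) * real CARD('a) * B \<le> D" and \<alpha>: "0 \<le> \<alpha>" "\<alpha> \<le> 1"
  shows "(norm (gx \<alpha> \<eta> s a s' sh ah (l, m)))\<^sup>2 \<le> 8 * D\<^sup>2"
    and "\<lbrakk>\<And>i. \<bar>Q $ i\<bar> \<le> B; \<And>s. \<bar>V $ s\<bar> \<le> B\<rbrakk>
      \<Longrightarrow> \<bar>gx \<alpha> \<eta> s a s' sh ah (l, m) \<bullet> (Q, V)\<bar> \<le> 4 * D * B"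
proof -
  define c where "c = real CARD('s) * real CARD('a) * l $ (sh, ah)"
  define h where "h = real CARD('s) * \<eta> $ sh"
  define e where "e = m $ (s, a)"
  have "0 \<le> l $ (sh, ah)" "l $ (sh, ah) \<le> B"
    using l by (auto simp: mem_nonneg_box)
  hence c: "0 \<le> c" "c \<le> D"
    using n unfolding c_def by (auto intro: order_trans[OF mult_left_mono])
  have e: "0 \<le> e" "e \<le> D"
    using m by (auto simp: mem_nonneg_box e_def)
  \<comment> \<open>The two terms along \<open>axis sh 1\<close> are merged: \<open>h\<close> and
    \<open>c\<close> both lie in [0, D], hence their difference has modulus at most
    \<open>D\<close>. Four coefficients of size at most \<open>D\<close> remain in total.\<close>
  have ch: "\<bar>h - c\<bar> \<le> D"
    using \<eta> c by (auto simp: h_def)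
  have \<alpha>e: "0 \<le> \<alpha> * e" "\<alpha> * e \<le> D"
    using e \<alpha> mult_mono[of \<alpha> 1 e D] by auto
  have g: "gx \<alpha> \<eta> s a s' sh ah (l, m) = (c *\<^sub>R axis (sh, ah) 1 - e *\<^sub>R axis (s, a) 1,
      (h - c) *\<^sub>R axis sh 1 - (- (\<alpha> * e)) *\<^sub>R axis s' 1)"
    by (simp add: gx_def c_def e_def h_def algebra_simps)
  have "norm (c *\<^sub>R axis (sh, ah) (1::real) - e *\<^sub>R axis (s, a) 1) \<le> 2 * D"
    using norm_diff_axis_le[of c "(sh, ah)" e "(s, a)"] c e by simp
  hence "(norm (c *\<^sub>R axis (sh, ah) (1::real) - e *\<^sub>R axis (s, a) 1))\<^sup>2 \<le> (2 * D)\<^sup>2"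
    by (intro power_mono) auto
  moreover have "norm ((h - c) *\<^sub>R axis sh (1::real) - (- (\<alpha> * e)) *\<^sub>R axis s' 1) \<le> 2 * D"
    using norm_diff_axis_le[of "h - c" sh "- (\<alpha> * e)" s'] ch \<alpha>e by simp
  hence "(norm ((h - c) *\<^sub>R axis sh (1::real) - (- (\<alpha> * e)) *\<^sub>R axis s' 1))\<^sup>2 \<le> (2 * D)\<^sup>2"
    by (intro power_mono) auto
  ultimately show "(norm (gx \<alpha> \<eta> s a s' sh ah (l, m)))\<^sup>2 \<le> 8 * D\<^sup>2"
    unfolding g norm_Pair_square by (simp add: power_mult_distrib)
  assume Q: "\<And>i. \<bar>Q $ i\<bar> \<le> B" and V: "\<And>s. \<bar>V $ s\<bar> \<le> B"
  have D: "0 \<le> D" using c by simp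
  have "gx \<alpha> \<eta> s a s' sh ah (l, m) \<bullet> (Q, V)
      = c * Q $ (sh, ah) - e * Q $ (s, a) + ((h - c) * V $ sh + (\<alpha> * e) * V $ s')"
    unfolding g by (simp add: inner_diff_left inner_add_left inner_axis')
  moreover have "\<bar>c * Q $ (sh, ah)\<bar> \<le> D * B" "\<bar>e * Q $ (s, a)\<bar> \<le> D * B"
    "\<bar>(h - c) * V $ sh\<bar> \<le> D * B" "\<bar>(\<alpha> * e) * V $ s'\<bar> \<le> D * B"
    using c e ch \<alpha>e D Q V unfolding abs_mult by (auto intro!: mult_mono simp: abs_of_nonneg)
  ultimately show "\<bar>gx \<alpha> \<eta> s a s' sh ah (l, m) \<bullet> (Q, V)\<bar> \<le> 4 * D * B"
    by linarith
qed

lemma gy_bounds: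
  fixes Q :: "real ^ ('s::finite \<times> 'a::finite)"
  assumes Q: "Q \<in> nonneg_box B" and V: "V \<in> nonneg_box B"
    and rew: "0 \<le> rew" "rew \<le> (1 - \<alpha>) * B"
    and n: "real CARD('s) * real CARD('a) * B \<le> D" "B \<le> D" and \<alpha>: "0 \<le> \<alpha>" "\<alpha> \<le> 1"
  shows "(norm (gy \<alpha> s a s' rew sh ah (Q, V)))\<^sup>2 \<le> 2 * D\<^sup>2"
    and "\<lbrakk>\<And>i. \<bar>l $ i\<bar> \<le> B; \<And>i. \<bar>m $ i\<bar> \<le> D\<rbrakk>
      \<Longrightarrow> \<bar>gy \<alpha> s a s' rew sh ah (Q, V) \<bullet> (l, m)\<bar> \<le> 2 * D * B"
proof -
  define c where "c = real CARD('s) * real CARD('a) * (Q $ (sh, ah) - V $ sh)"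
  define e where "e = \<alpha> * V $ s' + rew - Q $ (s, a)"
  have Qb: "0 \<le> Q $ i" "Q $ i \<le> B" for i using Q unfolding mem_nonneg_box by blast+
  have Vb: "0 \<le> V $ i" "V $ i \<le> B" for i using V unfolding mem_nonneg_box by blast+
  have B: "0 \<le> B" using Vb by (rule order_trans)
  have "\<bar>Q $ (sh, ah) - V $ sh\<bar> \<le> B"
    using Qb[of "(sh, ah)"] Vb[of sh] by simp
  hence "real CARD('s) * real CARD('a) * \<bar>Q $ (sh, ah) - V $ sh\<bar> \<le> real CARD('s) * real CARD('a) * B"
    by (intro mult_left_mono) auto
  from this n(1) have "real CARD('s) * real CARD('a) * \<bar>Q $ (sh, ah) - V $ sh\<bar> \<le> D"
    by (rule order_trans)
  hence c: "\<bar>c\<bar> \<le> D"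
    by (simp add: c_def abs_mult)
  have "0 \<le> \<alpha> * V $ s'" "\<alpha> * V $ s' \<le> \<alpha> * B"
    using \<alpha> Vb by (auto intro: mult_left_mono)
  \<comment> \<open>The reward bound (1 - \<alpha>) B keeps \<alpha> V + rew inside [0, B], like Q.
    Having B here instead of D matters: in the inner product this coefficient meets entries as large
    as D.\<close>
  hence e: "\<bar>e\<bar> \<le> B"
    using Qb[of "(s, a)"] rew by (auto simp: e_def algebra_simps)
  have g: "gy \<alpha> s a s' rew sh ah (Q, V) = (c *\<^sub>R axis (sh, ah) 1, e *\<^sub>R axis (s, a) 1)"
    by (simp add: gy_def c_def e_def)
  have "c\<^sup>2 \<le> D\<^sup>2" "e\<^sup>2 \<le> D\<^sup>2"
    using c e n(2) by (auto simp flip: abs_le_square_iff)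
  thus "(norm (gy \<alpha> s a s' rew sh ah (Q, V)))\<^sup>2 \<le> 2 * D\<^sup>2"
    unfolding g norm_Pair_square by simp
  assume l: "\<And>i. \<bar>l $ i\<bar> \<le> B" and m: "\<And>i. \<bar>m $ i\<bar> \<le> D"
  have "gy \<alpha> s a s' rew sh ah (Q, V) \<bullet> (l, m) = c * l $ (sh, ah) + e * m $ (s, a)"
    unfolding g by (simp add: inner_axis')
  moreover have "\<bar>c * l $ (sh, ah)\<bar> \<le> D * B" "\<bar>e * m $ (s, a)\<bar> \<le> B * D"
    using c e B n(2) l m unfolding abs_mult by (auto intro!: mult_mono)
  ultimately show "\<bar>gy \<alpha> s a s' rew sh ah (Q, V) \<bullet> (l, m)\<bar> \<le> 2 * D * B"
    by (simp add: mult.commute)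
qed

lemma closest_point_iterates_mem:
  assumes "C \<subseteq> C'" "closed C" "C \<noteq> {}" "z 0 \<in> C'" "\<And>k. z (Suc k) = closest_point C (f k)"
  shows "z k \<in> C'"
  using assms closest_point_in_set[of C] by (cases k) auto

text \<open>The primal comparator is constant and has no drift cost; dual ascent is read as descent
  along \<open>- gyk k\<close>. The gradient bounds 8 and 2 add up to the 10 in the
  conclusion.\<close>

lemma spd_regret:
  fixes x gxk :: "nat \<Rightarrow> ('s::finite, 'a::finite) primal" and y gyk :: "nat \<Rightarrow> ('s, 'a) dual"
    and w :: "nat \<Rightarrow> real ^ ('s \<times> 'a)" and B D \<alpha> \<zeta> \<sigma> \<gamma>0 \<beta>0 :: real
  assumes B: "B = \<sigma> / (1 - \<alpha>)" and D: "D = B / \<zeta>" and \<eta>: "norm1 \<eta> = \<sigma>"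
    and pos: "0 \<le> B" "0 < \<zeta>" "0 < \<gamma>0" "0 \<le> \<beta>0"
    and n: "real CARD('s) * real CARD('a) * \<zeta> \<le> 1"
    and gxk: "\<And>k. (norm (gxk k))\<^sup>2 \<le> 8 * D\<^sup>2" and gyk: "\<And>k. (norm (gyk k))\<^sup>2 \<le> 2 * D\<^sup>2"
    and x: "\<And>k. x k \<in> X_set \<alpha> \<sigma>"
      "\<And>k. x (Suc k) = closest_point (X_set \<alpha> \<sigma>) (x k - (\<gamma>0 / sqrt (real (k + 1))) *\<^sub>R gxk k)"
    and y: "\<And>k. y k \<in> L_set \<alpha> \<eta> \<times> M_set \<alpha> \<zeta> \<eta>"
      "\<And>k. y (Suc k) = closest_point (Y_set \<alpha> \<zeta> \<eta>) (y k + (\<gamma>0 / sqrt (real (k + 1))) *\<^sub>R gyk k)"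
    and xs: "xs \<in> X_set \<alpha> \<sigma>" and u: "\<And>k. (l, w k) \<in> Y_set \<alpha> \<zeta> \<eta>"
    and w: "\<And>k. norm (w k - w (Suc k)) \<le> \<beta>0 / real (k + 1) * B"
  shows "(\<Sum>k<T. gxk k \<bullet> (x k - xs) + gyk k \<bullet> ((l, w k) - y k))
    \<le> sqrt (real T) * (2 * D\<^sup>2 / (\<zeta> * \<gamma>0) + 2 * \<beta>0 * D\<^sup>2 / \<gamma>0 + 10 * \<gamma>0 * D\<^sup>2)"
proof -
  define n where "n = real CARD('s) * real CARD('a)"
  have n1: "1 \<le> real CARD('s)" "1 \<le> real CARD('a)"
    by (simp_all add: Suc_leI)
  have n2: "1 \<le> n" using mult_mono[OF n1] by (simp add: n_def)
  have nsq: "n * c\<^sup>2 \<le> (n * c)\<^sup>2" for c :: real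
  proof -
    have "1 * (n * c\<^sup>2) \<le> n * (n * c\<^sup>2)"
      using n2 by (intro mult_right_mono) auto
    thus ?thesis by (simp add: power2_eq_square mult_ac)
  qed
  have nS: "real CARD('s) \<le> n" using mult_left_mono[OF n1(2), of "real CARD('s)"] by (simp add: n_def)
  have n\<zeta>: "n \<le> 1 / \<zeta>" using n pos by (simp add: n_def field_simps)
  have nB: "n * B \<le> D"
    using mult_right_mono[OF n\<zeta> pos(1)] by (simp add: D)
  have D0: "0 \<le> D" using pos by (simp add: D)
  have Xb: "nonneg_box B \<times> nonneg_box B = X_set \<alpha> \<sigma>" by (simp add: X_set_eq B)
  have Lb: "L_set \<alpha> \<eta> = nonneg_box B" and Mb: "M_set \<alpha> \<zeta> \<eta> = nonneg_box D"
    by (simp_all add: L_set_def M_set_def \<eta> B D mult.commute)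
  have regx: "(\<Sum>k<T. gxk k \<bullet> (x k - xs))
      \<le> sqrt (real T) * ((2 * (n * B\<^sup>2)) / (2 * \<gamma>0) + 0 / \<gamma>0 + \<gamma>0 * (8 * D\<^sup>2))"
  proof (rule projected_gradient_regret[OF convex_X_set closed_X_set xs pos(3) x(2)])
    fix k
    obtain Q V where "x k = (Q, V)" "Q \<in> nonneg_box B" "V \<in> nonneg_box B"
      using x(1)[of k] by (auto simp flip: Xb)
    moreover obtain Q' V' where "xs = (Q', V')" "Q' \<in> nonneg_box B" "V' \<in> nonneg_box B"
      using xs by (auto simp flip: Xb)
    ultimately have "(norm (x k - xs))\<^sup>2 \<le> n * B\<^sup>2 + real CARD('s) * B\<^sup>2"
      using norm_nonneg_box_diff_le[of Q B Q'] norm_nonneg_box_diff_le[of V B V']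
      by (simp add: norm_Pair_square n_def)
    thus "(norm (x k - xs))\<^sup>2 \<le> 2 * (n * B\<^sup>2)"
      using mult_right_mono[OF nS, of "B\<^sup>2"] by simp
  qed (use gxk in auto)
  have regy: "(\<Sum>k<T. (- gyk k) \<bullet> (y k - (l, w k)))
      \<le> sqrt (real T) * ((n * B\<^sup>2 + n * D\<^sup>2) / (2 * \<gamma>0) + (2 * \<beta>0 * D\<^sup>2) / \<gamma>0 + \<gamma>0 * (2 * D\<^sup>2))"
  proof (rule projected_gradient_regret[OF convex_Y_set closed_Y_set u pos(3)])
    fix k
    have l: "l \<in> nonneg_box B" and wD: "w j \<in> nonneg_box D" for j
      using u[of j] by (auto simp: Y_set_def Lb Mb)
    have yb: "fst (y j) \<in> nonneg_box B" "snd (y j) \<in> nonneg_box D" for j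
      using y(1)[of j] by (auto simp: Lb Mb mem_Times_iff)
    show "y (Suc k) = closest_point (Y_set \<alpha> \<zeta> \<eta>) (y k - (\<gamma>0 / sqrt (real (k + 1))) *\<^sub>R - gyk k)"
      using y(2)[of k] by simp
    have dec: "(norm (y j - (l, w i)))\<^sup>2 = (norm (fst (y j) - l))\<^sup>2 + (norm (snd (y j) - w i))\<^sup>2" for i j
      by (cases "y j") (simp add: norm_Pair_square)
    show "(norm (y k - (l, w k)))\<^sup>2 \<le> n * B\<^sup>2 + n * D\<^sup>2"
      unfolding dec using norm_nonneg_box_diff_le[OF yb(1) l] norm_nonneg_box_diff_le[OF yb(2) wD]
      by (intro add_mono) (simp_all add: n_def)
    show "(norm (- gyk k))\<^sup>2 \<le> 2 * D\<^sup>2" using gyk by simp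
    show "0 \<le> 2 * \<beta>0 * D\<^sup>2" using pos by simp
    have len: "norm (snd (y (Suc k)) - w j) \<le> n * D" for j
    proof -
      have "(norm (snd (y (Suc k)) - w j))\<^sup>2 \<le> n * D\<^sup>2"
        using norm_nonneg_box_diff_le[OF yb(2) wD] by (simp add: n_def)
      also have "\<dots> \<le> (n * D)\<^sup>2"
        by (rule nsq)
      finally show ?thesis
        using n2 D0 by (intro power2_le_imp_le[of "norm _"]) auto
    qed
    have dsq: "(norm a)\<^sup>2 - (norm b)\<^sup>2 = (a - b) \<bullet> (a + b)" for a b :: "real ^ ('s \<times> 'a)"
      unfolding power2_norm_eq_inner inner_diff_left inner_add_right by (simp add: inner_commute)
    let ?p = "snd (y (Suc k)) - w (Suc k)" and ?q = "snd (y (Suc k)) - w k"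
    \<comment> \<open>As an inner product, one factor is the comparator's move, at most \<beta>0 B /
      (k + 1), and the other is at most 2 n D. The factor n is then absorbed by n B \<le> D.\<close>
    have "(norm ?p)\<^sup>2 - (norm ?q)\<^sup>2 = (?p - ?q) \<bullet> (?p + ?q)"
      by (rule dsq)
    also have "\<dots> \<le> norm (?p - ?q) * norm (?p + ?q)"
      by (rule norm_cauchy_schwarz)
    also have "\<dots> \<le> (\<beta>0 / real (k + 1) * B) * (2 * (n * D))"
    proof (rule mult_mono)
      show "norm (?p - ?q) \<le> \<beta>0 / real (k + 1) * B"
        using w[of k] by simp
      show "norm (?p + ?q) \<le> 2 * (n * D)"
        using norm_triangle_ineq[of ?p ?q] len[of k] len[of "Suc k"] by linarith
    qed (use pos in auto)
    also have "\<dots> = (2 * \<beta>0 * D / real (k + 1)) * (n * B)"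
      by simp
    also have "\<dots> \<le> (2 * \<beta>0 * D / real (k + 1)) * D"
      using nB D0 pos by (intro mult_left_mono) auto
    finally show "(norm (y (Suc k) - (l, w (Suc k))))\<^sup>2 - (norm (y (Suc k) - (l, w k)))\<^sup>2
        \<le> 2 * \<beta>0 * D\<^sup>2 / real (k + 1)"
      unfolding dec by (simp add: power2_eq_square)
  qed
  have "B\<^sup>2 * n \<le> D\<^sup>2"
  proof -
    have "B\<^sup>2 * n \<le> (n * B)\<^sup>2"
      using nsq[of B] by (simp only: mult.commute)
    also have "\<dots> \<le> D\<^sup>2" using nB n2 pos by (intro power_mono) auto
    finally show ?thesis .
  qed
  also have D\<zeta>: "D\<^sup>2 \<le> D\<^sup>2 / \<zeta>"
    using n\<zeta> n2 mult_left_mono[of 1 "1 / \<zeta>" "D\<^sup>2"] by simp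
  finally have b1: "n * B\<^sup>2 \<le> D\<^sup>2 / \<zeta>" by (simp add: mult.commute)
  have b2: "n * D\<^sup>2 \<le> D\<^sup>2 / \<zeta>"
    using mult_right_mono[OF n\<zeta>, of "D\<^sup>2"] by simp
  \<comment> \<open>There are four summands over 2 \<gamma>0, each at most D^2 / \<zeta>.\<close>
  have "(2 * (n * B\<^sup>2)) / (2 * \<gamma>0) + (n * B\<^sup>2 + n * D\<^sup>2) / (2 * \<gamma>0)
      = (2 * (n * B\<^sup>2) + (n * B\<^sup>2 + n * D\<^sup>2)) / (2 * \<gamma>0)"
    by (rule add_divide_distrib[symmetric])
  also have "\<dots> \<le> (4 * (D\<^sup>2 / \<zeta>)) / (2 * \<gamma>0)"
    using b1 b2 pos by (intro divide_right_mono) auto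
  finally have b: "(2 * (n * B\<^sup>2)) / (2 * \<gamma>0) + (n * B\<^sup>2 + n * D\<^sup>2) / (2 * \<gamma>0) \<le> 2 * D\<^sup>2 / (\<zeta> * \<gamma>0)"
    by (simp add: mult.commute)
  have "(\<Sum>k<T. gxk k \<bullet> (x k - xs) + gyk k \<bullet> ((l, w k) - y k))
      = (\<Sum>k<T. gxk k \<bullet> (x k - xs)) + (\<Sum>k<T. (- gyk k) \<bullet> (y k - (l, w k)))"
    by (simp add: sum.distrib inner_diff_right sum_subtractf)
  also have "\<dots> \<le> sqrt (real T) * (((2 * (n * B\<^sup>2)) / (2 * \<gamma>0) + (n * B\<^sup>2 + n * D\<^sup>2) / (2 * \<gamma>0))
      + 2 * \<beta>0 * D\<^sup>2 / \<gamma>0 + 10 * \<gamma>0 * D\<^sup>2)"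
    using regx regy by (simp add: algebra_simps)
  also have "\<dots> \<le> sqrt (real T) * (2 * D\<^sup>2 / (\<zeta> * \<gamma>0) + 2 * \<beta>0 * D\<^sup>2 / \<gamma>0 + 10 * \<gamma>0 * D\<^sup>2)"
    using b by (intro mult_left_mono add_right_mono) auto
  finally show ?thesis .
qed

section \<open>Convergence of SPD Q-learning\<close>

theorem theorem16:
  fixes P :: "'a::finite \<Rightarrow> real ^ 's ^ 's::finite"
    and r :: "'s \<Rightarrow> 's \<Rightarrow> 'a \<Rightarrow> real"
    and \<alpha> \<sigma> \<zeta> \<gamma>0 \<beta>0 \<epsilon> \<delta> :: real
    and R :: "real ^ ('s \<times> 'a)"
    and \<eta> :: "real ^ 's"
    and W :: "'w measure"
    and F :: "nat \<Rightarrow> 'w measure"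
    and S S' Sh :: "nat \<Rightarrow> 'w \<Rightarrow> 's"
    and A Ah :: "nat \<Rightarrow> 'w \<Rightarrow> 'a"
    and rh :: "nat \<Rightarrow> 's \<Rightarrow> 's \<Rightarrow> 'a \<Rightarrow> 'w \<Rightarrow> real"
    and \<tau> :: "nat \<Rightarrow> 's \<Rightarrow> 'a \<Rightarrow> real"
    and M :: "nat \<Rightarrow> real ^ ('s \<times> 'a) ^ ('s \<times> 'a)"
    and Minf :: "real ^ ('s \<times> 'a) ^ ('s \<times> 'a)"
    and \<gamma> :: "nat \<Rightarrow> real"
    and x :: "nat \<Rightarrow> 'w \<Rightarrow> ('s, 'a) primal"
    and y :: "nat \<Rightarrow> 'w \<Rightarrow> ('s, 'a) dual"
    and gxk :: "nat \<Rightarrow> 'w \<Rightarrow> ('s, 'a) primal"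
    and gyk :: "nat \<Rightarrow> 'w \<Rightarrow> ('s, 'a) dual"
    and ls :: "real ^ ('s \<times> 'a)"
    and T :: nat
  \<comment> \<open>the Markov decision process\<close>
  assumes "0 \<le> \<alpha>" "\<alpha> < 1" "1 \<le> \<sigma>"
    and "\<And>a. row_stochastic (P a)"
    and "R = stacked_R P r"
    and "\<eta> = (\<chi> s. \<sigma> / real CARD('s))"
    and "dual_optimal \<alpha> \<eta> P R ls"
  \<comment> \<open>the random rewards\<close>
    and "prob_space W"
    and "\<And>k s s' a. rh k s s' a \<in> borel_measurable W"
    and "\<And>k s s' a. AE \<omega> in W. 0 \<le> rh k s s' a \<omega> \<and> rh k s s' a \<omega> \<le> \<sigma>"
    and "\<And>k s s' a. prob_space.expectation W (rh k s s' a) = r s s' a"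
  \<comment> \<open>the observed pairs, the observed next states and the uniform samples\<close>
    and "\<And>k. S k \<in> W \<rightarrow>\<^sub>M count_space UNIV" "\<And>k. A k \<in> W \<rightarrow>\<^sub>M count_space UNIV"
        "\<And>k. S' k \<in> W \<rightarrow>\<^sub>M count_space UNIV"
        "\<And>k. Sh k \<in> W \<rightarrow>\<^sub>M count_space UNIV" "\<And>k. Ah k \<in> W \<rightarrow>\<^sub>M count_space UNIV"
    and "\<And>k s a. measure W {\<omega> \<in> space W. S k \<omega> = s \<and> A k \<omega> = a} = \<tau> k s a"
    and "\<And>k s a s'. measure W {\<omega> \<in> space W. S k \<omega> = s \<and> A k \<omega> = a \<and> S' k \<omega> = s'}
           = \<tau> k s a * P a $ s $ s'"
    and "\<And>k s a. measure W {\<omega> \<in> space W. Sh k \<omega> = s \<and> Ah k \<omega> = a}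
           = 1 / (real CARD('s) * real CARD('a))"
  \<comment> \<open>the state-action distributions\<close>
    and "\<And>k. M k = dist_matrix (\<tau> k)"
    and "0 < \<zeta>" "\<And>k s a. \<zeta> \<le> \<tau> k s a"
    and "M \<longlonglongrightarrow> Minf" "\<And>i. 0 < Minf $ i $ i" "\<And>i j. i \<noteq> j \<Longrightarrow> Minf $ i $ j = 0"
    and "0 < \<beta>0"
    and "\<And>k. onorm (\<lambda>v. (matrix_inv (M k) - matrix_inv (M (Suc k))) *v v) \<le> \<beta>0 / real (k + 1)"
  \<comment> \<open>the algorithm\<close>
    and "0 < \<gamma>0" "\<And>k. \<gamma> k = \<gamma>0 / sqrt (real (k + 1))"
    and "\<And>k \<omega>. gxk k \<omega> = gx \<alpha> \<eta> (S k \<omega>) (A k \<omega>) (S' k \<omega>) (Sh k \<omega>) (Ah k \<omega>) (y k \<omega>)"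
    and "\<And>k \<omega>. gyk k \<omega> = gy \<alpha> (S k \<omega>) (A k \<omega>) (S' k \<omega>)
           (rh k (S k \<omega>) (S' k \<omega>) (A k \<omega>) \<omega>) (Sh k \<omega>) (Ah k \<omega>) (x k \<omega>)"
    and "\<And>\<omega>. \<omega> \<in> space W \<Longrightarrow> x 0 \<omega> \<in> X_set \<alpha> \<sigma>"
    and "\<And>\<omega>. \<omega> \<in> space W \<Longrightarrow> y 0 \<omega> \<in> L_set \<alpha> \<eta> \<times> M_set \<alpha> \<zeta> \<eta>"
    and "\<And>k \<omega>. \<omega> \<in> space W \<Longrightarrow>
           x (Suc k) \<omega> = closest_point (X_set \<alpha> \<sigma>) (x k \<omega> - \<gamma> k *\<^sub>R gxk k \<omega>)"
    and "\<And>k \<omega>. \<omega> \<in> space W \<Longrightarrow>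
           y (Suc k) \<omega> = closest_point (Y_set \<alpha> \<zeta> \<eta>) (y k \<omega> + \<gamma> k *\<^sub>R gyk k \<omega>)"
  \<comment> \<open>unbiasedness of the stochastic gradients given the history of the algorithm\<close>
    and "filtration (space W) F" "\<And>k. subalgebra W (F k)"
    and "x 0 \<in> borel_measurable (F 0)" "y 0 \<in> borel_measurable (F 0)"
    and "\<And>k. gxk k \<in> borel_measurable (F (Suc k))" "\<And>k. gyk k \<in> borel_measurable (F (Suc k))"
    and "\<And>k. cond_mean_zero W (F k)
           (\<lambda>\<omega>. gxk k \<omega> - grad (\<lambda>z. lagrangian \<alpha> \<eta> P R (M k) z (y k \<omega>)) (x k \<omega>))"
    and "\<And>k. cond_mean_zero W (F k)
           (\<lambda>\<omega>. gyk k \<omega> - grad (\<lambda>z. lagrangian \<alpha> \<eta> P R (M k) (x k \<omega>) z) (y k \<omega>))"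
  \<comment> \<open>accuracy, confidence and number of iterations\<close>
    and "0 < \<epsilon>" "\<epsilon> < 1" "0 < \<delta>" "\<delta> < 1 / exp 1"
    and "real T \<ge> max (kappa1 (real CARD('s)) (real CARD('a)) \<zeta> \<beta>0 \<gamma>0) (kappa2 \<gamma>0)
           * (\<sigma>^4 * real CARD('s)^4 * real CARD('a)^4 / (\<zeta>^4 * (1 - \<alpha>)^4))
           * (1 / \<epsilon>^2) * ln (1 / \<delta>)"
  shows "measure W {\<omega> \<in> space W.
           pseudo_gap \<alpha> \<eta> P R ls (x_average (\<lambda>k. x k \<omega>) T) (y_average M (\<lambda>k. y k \<omega>) T) \<le> \<epsilon>}
         \<ge> 1 - \<delta>"
proof -
  note \<alpha> = assms(1,2) and \<sigma>1 = assms(3) and P = assms(4) and Req = assms(5) and \<eta>eq = assms(6)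
    and ls_opt = assms(7) and W = assms(8) and rh_meas = assms(9) and rh_AE = assms(10)
    and rh_mean = assms(11) and S_meas [measurable] = assms(12) and A_meas [measurable] = assms(13)
    and \<tau> = assms(17) and M = assms(20) and \<zeta>0 = assms(21) and \<tau>\<zeta> = assms(22) and \<beta>0 = assms(26)
    and drift = assms(27) and \<gamma>0 = assms(28) and \<gamma> = assms(29) and gxk = assms(30) and gyk = assms(31)
    and x0 = assms(32) and y0 = assms(33) and xstep = assms(34) and ystep = assms(35)
    and F = assms(36,37) and x0F = assms(38) and y0F = assms(39) and gxF = assms(40) and gyF = assms(41)
    and unbx = assms(42) and unby = assms(43) and \<epsilon> = assms(44) and \<delta> = assms(46,47) and T = assms(48)
  interpret prob_space W by (rule W)

  \<comment> \<open>Radii of the boxes and the dimension bound\<close>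
  define n where "n = real CARD('s) * real CARD('a)"
  define B where "B = \<sigma> / (1 - \<alpha>)"
  define D where "D = B / \<zeta>"
  have n1: "1 \<le> real CARD('s)" "1 \<le> real CARD('a)"
    by (simp_all add: Suc_leI)
  have n2: "1 \<le> n" using mult_mono[OF n1] by (simp add: n_def)
  have B0: "0 < B" and \<sigma>B: "\<sigma> \<le> B" and \<sigma>eq: "\<sigma> = (1 - \<alpha>) * B"
    using \<alpha> \<sigma>1 by (auto simp: B_def field_simps)
  have D0: "0 < D" using B0 \<zeta>0 by (simp add: D_def)
  \<comment> \<open>The n events of the observed pair at time 0 are disjoint, and each has
    probability at least \<zeta>.\<close>
  have n\<zeta>: "n * \<zeta> \<le> 1"
  proof -
    define E where "E i = {\<omega> \<in> space W. S 0 \<omega> = fst i \<and> A 0 \<omega> = snd i}" for i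
    have "measure W (\<Union>i\<in>UNIV. E i) = (\<Sum>i\<in>UNIV. measure W (E i))"
    proof (rule finite_measure_finite_Union)
      have "E i \<in> sets W" for i unfolding E_def by measurable
      thus "range E \<subseteq> sets W" by auto
      show "disjoint_family E" by (auto simp: disjoint_family_on_def E_def prod_eq_iff)
    qed simp
    also have "\<dots> = (\<Sum>i\<in>UNIV. \<tau> 0 (fst i) (snd i))" by (simp add: E_def \<tau>)
    also have "\<dots> \<ge> (\<Sum>i\<in>(UNIV :: ('s \<times> 'a) set). \<zeta>)" by (intro sum_mono \<tau>\<zeta>)
    finally have "n * \<zeta> \<le> measure W (\<Union>i\<in>UNIV. E i)" by (simp add: n_def)
    thus ?thesis using prob_le_1[of "\<Union>i\<in>UNIV. E i"] by linarith
  qed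
  have nB: "n * B \<le> D"
    using mult_right_mono[OF n\<zeta>, of B] B0 \<zeta>0 by (simp add: D_def field_simps)
  have BD: "B \<le> D" using mult_right_mono[OF n2, of B] nB B0 by linarith
  have r: "0 \<le> r s s' a" "r s s' a \<le> \<sigma>" for s s' a
  proof -
    have int: "integrable W (rh 0 s s' a)"
      using rh_meas rh_AE[of 0 s s' a] by (intro integrable_const_bound[of _ \<sigma>]) auto
    show "0 \<le> r s s' a" "r s s' a \<le> \<sigma>"
      using rh_AE[of 0 s s' a] int unfolding rh_mean[of 0, symmetric]
      by (auto intro!: integral_ge_const integral_le_const)
  qed
  have R: "0 \<le> R $ i" "R $ i \<le> \<sigma>" for i
    using row_stochastic_average_bounds[OF P, of "\<lambda>s'. r (fst i) s' (snd i)" \<sigma>, OF r]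
    by (auto simp: Req stacked_R_def)

  \<comment> \<open>Bounds for the saddle point\<close>
  define Vs where "Vs = optimal_V \<alpha> P R"
  define Qs where "Qs = optimal_Q \<alpha> P R"
  have Vs: "0 \<le> Vs $ s" "Vs $ s \<le> B" for s
    using optimal_V_bounds[of P R \<sigma> \<alpha>, OF P R \<alpha>] by (auto simp: Vs_def B_def)
  have Qs: "0 \<le> Qs $ i" "Qs $ i \<le> B" for i
    using optimal_Q_bounds[of P R \<sigma> \<alpha>, OF P R \<alpha>] by (auto simp: Qs_def B_def)
  have feas: "dual_feasible \<alpha> \<eta> P ls"
    using ls_opt by (simp add: dual_optimal_def)
  have \<eta>: "norm1 \<eta> = \<sigma>" "(\<Sum>s\<in>UNIV. \<eta> $ s) = \<sigma>" "real CARD('s) * \<eta> $ s = \<sigma>" "0 \<le> \<eta> $ s" for s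
    using \<sigma>1 by (simp_all add: \<eta>eq norm1_def)
  have ls0: "0 \<le> ls $ i" for i using feas unfolding dual_feasible_def by blast
  \<comment> \<open>Since \<open>ls\<close> is nonnegative, this is its l1 norm; it bounds the
    entries and the Euclidean norm with no dimension factor.\<close>
  have ls_sum: "(\<Sum>i\<in>UNIV. ls $ i) = B"
    using dual_feasible_sum[OF feas P \<alpha>(2)] by (simp add: \<eta> B_def)
  have ls_le: "ls $ i \<le> B" for i
    using member_le_sum[of i UNIV "\<lambda>i. ls $ i"] ls0 by (simp add: ls_sum)
  have ls_norm: "norm ls \<le> B"
    using norm_le_l1_cart[of ls] ls0 by (simp add: ls_sum)
  have L_eq: "L_set \<alpha> \<eta> = nonneg_box B" and M_eq: "M_set \<alpha> \<zeta> \<eta> = nonneg_box D"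
    by (simp_all add: L_set_def M_set_def \<eta> B_def D_def mult.commute)
  have X_eq: "X_set \<alpha> \<sigma> = nonneg_box B \<times> nonneg_box B"
    by (simp add: X_set_eq B_def)
  have xs: "(Qs, Vs) \<in> X_set \<alpha> \<sigma>"
    by (simp add: X_eq mem_nonneg_box Qs Vs del: split_paired_All)

  \<comment> \<open>Drift of the dual comparator\<close>
  have \<tau>pos: "0 < \<tau> k s a" for k s a using \<tau>\<zeta>[of k s a] \<zeta>0 by linarith
  \<comment> \<open>\<open>(ls, w k)\<close> is the drifting comparator.\<close>
  define w where "w k = matrix_inv (M k) *v ls" for k
  have w_eq: "w k = (\<chi> i. inverse (\<tau> k (fst i) (snd i)) * ls $ i)" for k
    unfolding w_def M using \<tau>pos by (subst matrix_inv_dist_matrix) (auto simp: dist_matrix_vector less_imp_neq[symmetric])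
  have w_mem: "w k \<in> nonneg_box D" for k
    unfolding mem_nonneg_box
  proof
    fix i
    have "inverse (\<tau> k (fst i) (snd i)) * ls $ i \<le> inverse \<zeta> * B"
      using ls0 ls_le \<zeta>0 \<tau>\<zeta> by (intro mult_mono le_imp_inverse_le) auto
    thus "0 \<le> w k $ i \<and> w k $ i \<le> D"
      using ls0 \<tau>pos by (simp add: w_eq D_def less_imp_le divide_inverse mult.commute)
  qed
  have u_mem: "(ls, w k) \<in> Y_set \<alpha> \<zeta> \<eta>" for k
    using w_mem dual_feasible_mem_Xi_set[OF feas P \<alpha>(1)] ls0 ls_le
    by (simp add: Y_set_def L_eq M_eq mem_nonneg_box del: split_paired_All)
  have w_drift: "norm (w k - w (Suc k)) \<le> \<beta>0 / real (k + 1) * B" for k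
  proof -
    have "w k - w (Suc k) = (matrix_inv (M k) - matrix_inv (M (Suc k))) *v ls"
      by (simp add: w_def matrix_vector_mult_diff_rdistrib)
    also have "norm \<dots> \<le> onorm (\<lambda>v. (matrix_inv (M k) - matrix_inv (M (Suc k))) *v v) * norm ls"
      by (intro onorm) simp
    also have "\<dots> \<le> \<beta>0 / real (k + 1) * B"
      using drift \<beta>0 ls_norm by (intro mult_mono) auto
    finally show ?thesis .
  qed
  have w_pair: "w k \<bullet> (M k *v v) = ls \<bullet> v" for k v
    unfolding M dist_matrix_vector w_eq inner_vec_def using \<tau>pos
    by (intro sum.cong) (auto simp: less_imp_neq[symmetric])

  \<comment> \<open>The gap as an affine function of \<lambda>\<close>
  define gap where "gap l = ls \<bullet> R - (\<eta> \<bullet> Vs + l \<bullet> (Qs - stacked_I *v Vs))" for l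
  have gap_lagrangian: "lagrangian \<alpha> \<eta> P R (M k) z (ls, w k) - lagrangian \<alpha> \<eta> P R (M k) (Qs, Vs) v = gap (fst v)"
    for k z v
    unfolding gap_def Vs_def Qs_def
    by (cases v) (simp add: lagrangian_dual_feasible[OF feas w_pair] lagrangian_optimal_x)
  have pseudo_gap_eq: "pseudo_gap \<alpha> \<eta> P R ls z v = gap (fst v)" for z v
    unfolding gap_def Vs_def Qs_def
    by (cases v) (simp add: pseudo_gap_def lagrangian_dual_feasible[OF feas] lagrangian_optimal_x)
  \<comment> \<open>\<open>ls \<bullet> R\<close> and \<open>\<eta> \<bullet> Vs\<close> both lie in
    [0, B^2], so their difference costs one D B; the term in \<open>l\<close> has n entries of size
    B^2 and costs n B^2 \<le> D B.\<close>
  have gap_bound: "\<bar>gap l\<bar> \<le> 2 * D * B" if l: "l \<in> nonneg_box B" for l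
  proof -
    have "0 \<le> ls \<bullet> R" unfolding inner_vec_def using ls0 R by (auto intro!: sum_nonneg)
    moreover have "ls \<bullet> R \<le> (\<Sum>i\<in>UNIV. ls $ i * B)"
      unfolding inner_vec_def inner_real_def
      by (intro sum_mono mult_left_mono order_trans[OF R(2) \<sigma>B] ls0)
    hence "ls \<bullet> R \<le> B * B" by (simp add: ls_sum flip: sum_distrib_right)
    moreover have "0 \<le> \<eta> \<bullet> Vs" unfolding inner_vec_def using \<eta> Vs by (auto intro!: sum_nonneg)
    moreover have "\<eta> \<bullet> Vs \<le> (\<Sum>s\<in>UNIV. \<eta> $ s * B)"
      unfolding inner_vec_def inner_real_def by (intro sum_mono mult_left_mono Vs \<eta>)
    hence "\<eta> \<bullet> Vs \<le> \<sigma> * B" by (simp add: \<eta> flip: sum_distrib_right)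
    hence "\<eta> \<bullet> Vs \<le> B * B"
      using B0 mult_right_mono[OF \<sigma>B, of B] by linarith
    moreover have "\<bar>l \<bullet> (Qs - stacked_I *v Vs)\<bar> \<le> (\<Sum>i\<in>(UNIV :: ('s \<times> 'a) set). B * B)"
      unfolding inner_vec_def inner_real_def
    proof (rule order_trans[OF sum_abs], rule sum_mono)
      fix i
      have "\<bar>Qs $ i - Vs $ fst i\<bar> \<le> B" using Qs[of i] Vs[of "fst i"] by simp
      moreover have "\<bar>l $ i\<bar> \<le> B" using l unfolding mem_nonneg_box by (metis abs_of_nonneg)
      ultimately show "\<bar>l $ i * (Qs - stacked_I *v Vs) $ i\<bar> \<le> B * B"
        using B0 by (auto simp: abs_mult stacked_I_vector intro!: mult_mono)
    qed
    hence "\<bar>l \<bullet> (Qs - stacked_I *v Vs)\<bar> \<le> (n * B) * B" by (simp add: n_def mult.assoc)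
    hence "\<bar>l \<bullet> (Qs - stacked_I *v Vs)\<bar> \<le> D * B"
      using mult_right_mono[OF nB, of B] B0 by linarith
    moreover have "B * B \<le> D * B" using BD B0 by simp
    ultimately show ?thesis unfolding gap_def by linarith
  qed

  \<comment> \<open>Iterates and stochastic gradients stay bounded\<close>
  have x_mem: "x k \<omega> \<in> X_set \<alpha> \<sigma>" if "\<omega> \<in> space W" for k \<omega>
    by (rule closest_point_iterates_mem[where z = "\<lambda>k. x k \<omega>", OF order_refl closed_X_set _ x0[OF that] xstep[OF that]])
      (use xs in auto)
  \<comment> \<open>\<open>Y_set\<close> would be too small here: the initial \<open>y 0\<close> need not satisfy the constraint \<open>Xi_set\<close>.\<close>
  have y_mem: "y k \<omega> \<in> L_set \<alpha> \<eta> \<times> M_set \<alpha> \<zeta> \<eta>" if "\<omega> \<in> space W" for k \<omega>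
    by (rule closest_point_iterates_mem[where z = "\<lambda>k. y k \<omega>", OF _ closed_Y_set _ y0[OF that] ystep[OF that]])
      (use u_mem in \<open>auto simp: Y_set_def\<close>)
  have gxk_bounds: "(norm (gxk k \<omega>))\<^sup>2 \<le> 8 * D\<^sup>2" "\<bar>gxk k \<omega> \<bullet> (x k \<omega> - (Qs, Vs))\<bar> \<le> 4 * D * B"
    if \<omega>: "\<omega> \<in> space W" for k \<omega>
  proof -
    obtain l m where y: "y k \<omega> = (l, m)" "l \<in> nonneg_box B" "m \<in> nonneg_box D"
      using y_mem[OF \<omega>, of k] by (auto simp: L_eq M_eq)
    obtain Q V where x: "x k \<omega> = (Q, V)" "Q \<in> nonneg_box B" "V \<in> nonneg_box B"
      using x_mem[OF \<omega>, of k] by (auto simp: X_eq)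
    note g = gx_bounds[OF y(2,3) _ _ nB[unfolded n_def] \<alpha>(1) less_imp_le[OF \<alpha>(2)]]
    show "(norm (gxk k \<omega>))\<^sup>2 \<le> 8 * D\<^sup>2"
      unfolding gxk y(1) by (rule g) (use \<eta>(3) \<sigma>1 \<sigma>B BD in auto)
    have "\<bar>(Q - Qs) $ i\<bar> \<le> B" "\<bar>(V - Vs) $ s\<bar> \<le> B" for i s
      using x(2,3)[unfolded mem_nonneg_box, THEN spec] Qs Vs
      by (smt (verit) vector_minus_component)+
    thus "\<bar>gxk k \<omega> \<bullet> (x k \<omega> - (Qs, Vs))\<bar> \<le> 4 * D * B"
      unfolding gxk y(1) x(1) diff_Pair by (intro g) (use \<eta>(3) \<sigma>1 \<sigma>B BD in auto)
  qed
  have gyk_bounds: "(norm (gyk k \<omega>))\<^sup>2 \<le> 2 * D\<^sup>2" "\<bar>gyk k \<omega> \<bullet> ((ls, w k) - y k \<omega>)\<bar> \<le> 2 * D * B"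
    if \<omega>: "\<omega> \<in> space W" and rew: "\<And>s s' a. 0 \<le> rh k s s' a \<omega> \<and> rh k s s' a \<omega> \<le> \<sigma>" for k \<omega>
  proof -
    obtain l m where y: "y k \<omega> = (l, m)" "l \<in> nonneg_box B" "m \<in> nonneg_box D"
      using y_mem[OF \<omega>, of k] by (auto simp: L_eq M_eq)
    obtain Q V where x: "x k \<omega> = (Q, V)" "Q \<in> nonneg_box B" "V \<in> nonneg_box B"
      using x_mem[OF \<omega>, of k] by (auto simp: X_eq)
    note g = gy_bounds[OF x(2,3) _ _ nB[unfolded n_def] BD \<alpha>(1) less_imp_le[OF \<alpha>(2)]]
    show "(norm (gyk k \<omega>))\<^sup>2 \<le> 2 * D\<^sup>2"
      unfolding gyk x(1) by (rule g) (use rew \<sigma>eq in auto)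
    have "\<bar>(ls - l) $ i\<bar> \<le> B" "\<bar>(w k - m) $ i\<bar> \<le> D" for i
      using y(2,3)[unfolded mem_nonneg_box, THEN spec, of i] ls0[of i] ls_le[of i]
        w_mem[of k, unfolded mem_nonneg_box, THEN spec, of i]
      unfolding vector_minus_component by linarith+
    thus "\<bar>gyk k \<omega> \<bullet> ((ls, w k) - y k \<omega>)\<bar> \<le> 2 * D * B"
      unfolding gyk x(1) y(1) diff_Pair by (intro g) (use rew \<sigma>eq in auto)
  qed
  \<comment> \<open>One null set serves all times at once; the regret estimate is pathwise and
    involves every step.\<close>
  have rew_AE: "AE \<omega> in W. \<forall>k s s' a. 0 \<le> rh k s s' a \<omega> \<and> rh k s s' a \<omega> \<le> \<sigma>"
    using rh_AE by (simp only: AE_all_countable) simp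

  \<comment> \<open>Adaptedness of the iterates\<close>
  have spF: "space (F k) = space W" for k
    using filtration.space_F[OF F(1)] .
  have xF: "x k \<in> borel_measurable (F k)" for k
  proof (induction k)
    case (Suc k)
    have "(\<lambda>\<omega>. closest_point (X_set \<alpha> \<sigma>) (x k \<omega> - \<gamma> k *\<^sub>R gxk k \<omega>)) \<in> borel_measurable (F (Suc k))"
      using filtration_measurable_mono[OF F(1) _ Suc, of "Suc k"] gxF[of k] xs
      by (intro measurable_compose[OF _ borel_measurable_closest_point[OF convex_X_set closed_X_set]]
          borel_measurable_diff borel_measurable_scaleR borel_measurable_const) auto
    thus ?case
      by (subst measurable_cong[OF xstep]) (auto simp: spF)
  qed (rule x0F)
  have yF: "y k \<in> borel_measurable (F k)" for k
  proof (induction k)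
    case (Suc k)
    have "(\<lambda>\<omega>. closest_point (Y_set \<alpha> \<zeta> \<eta>) (y k \<omega> + \<gamma> k *\<^sub>R gyk k \<omega>)) \<in> borel_measurable (F (Suc k))"
      using filtration_measurable_mono[OF F(1) _ Suc, of "Suc k"] gyF[of k] u_mem
      by (intro measurable_compose[OF _ borel_measurable_closest_point[OF convex_Y_set closed_Y_set]]
          borel_measurable_add borel_measurable_scaleR borel_measurable_const) auto
    thus ?case
      by (subst measurable_cong[OF ystep]) (auto simp: spF)
  qed (rule y0F)
  have gap_meas: "(\<lambda>v. gap (fst v)) \<in> borel_measurable borel"
    unfolding gap_def by (intro borel_measurable_continuous_onI continuous_intros)

  \<comment> \<open>The martingale differences\<close>
  define h where "h k \<omega> = gxk k \<omega> \<bullet> (x k \<omega> - (Qs, Vs)) + gyk k \<omega> \<bullet> ((ls, w k) - y k \<omega>)" for k \<omega>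
  define d where "d k \<omega> = gap (fst (y k \<omega>)) - h k \<omega>" for k \<omega>
  have dF: "d k \<in> borel_measurable (F (Suc k))" for k
  proof -
    have [measurable]: "x k \<in> borel_measurable (F (Suc k))" "y k \<in> borel_measurable (F (Suc k))"
      using filtration_measurable_mono[OF F(1) _ xF] filtration_measurable_mono[OF F(1) _ yF] by auto
    note [measurable] = gxF[of k] gyF[of k] measurable_compose[OF _ gap_meas]
    show ?thesis unfolding d_def[abs_def] h_def by measurable
  qed
  \<comment> \<open>The 8 is 2 from the gap, 4 from the primal and 2 from the dual inner
    product.\<close>
  have d_bound: "AE \<omega> in W. \<bar>d k \<omega>\<bar> \<le> 8 * D * B" for k
    using rew_AE AE_space
  proof eventually_elim
    case (elim \<omega>)
    have "\<bar>gap (fst (y k \<omega>))\<bar> \<le> 2 * D * B"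
      using y_mem[OF elim(2), of k] by (intro gap_bound) (auto simp: L_eq)
    thus ?case
      using gxk_bounds(2)[OF elim(2), of k] gyk_bounds(2)[OF elim(2), of k] elim(1)
      unfolding d_def h_def by fastforce
  qed
  \<comment> \<open>\<open>d k\<close> is the inner product of the gradient noise with a vector known at time \<open>k\<close>.\<close>
  have d_mean: "AE \<omega> in W. real_cond_exp W (F k) (d k) \<omega> = 0" for k
  proof -
    let ?Z = "\<lambda>\<omega>. gxk k \<omega> - grad (\<lambda>z. lagrangian \<alpha> \<eta> P R (M k) z (y k \<omega>)) (x k \<omega>)"
    let ?Z' = "\<lambda>\<omega>. gyk k \<omega> - grad (\<lambda>z. lagrangian \<alpha> \<eta> P R (M k) (x k \<omega>) z) (y k \<omega>)"
    let ?p = "\<lambda>\<omega>. (Qs, Vs) - x k \<omega>" and ?q = "\<lambda>\<omega>. y k \<omega> - (ls, w k)"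
    have sub: "finite_measure_subalgebra W (F k)"
      using F(2) by unfold_locales
    interpret Fk: finite_measure_subalgebra W "F k" by (rule sub)
    \<comment> \<open>L(x_k, y_k) cancels between the two exact gradient terms; what remains is
      L(x*, y_k) - L(x_k, (ls, w k)), which is minus the gap.\<close>
    have d_eq: "d k = (\<lambda>\<omega>. ?Z \<omega> \<bullet> ?p \<omega> + ?Z' \<omega> \<bullet> ?q \<omega>)"
    proof
      fix \<omega>
      have 1: "grad (\<lambda>z. lagrangian \<alpha> \<eta> P R (M k) z (y k \<omega>)) (x k \<omega>) \<bullet> ?p \<omega>
          = lagrangian \<alpha> \<eta> P R (M k) (Qs, Vs) (y k \<omega>) - lagrangian \<alpha> \<eta> P R (M k) (x k \<omega>) (y k \<omega>)"
        by (rule grad_lagrangian_x)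
      have 2: "grad (\<lambda>z. lagrangian \<alpha> \<eta> P R (M k) (x k \<omega>) z) (y k \<omega>) \<bullet> ?q \<omega>
          = lagrangian \<alpha> \<eta> P R (M k) (x k \<omega>) (y k \<omega>) - lagrangian \<alpha> \<eta> P R (M k) (x k \<omega>) (ls, w k)"
        by (rule grad_lagrangian_y)
      have 3: "gxk k \<omega> \<bullet> ?p \<omega> + gyk k \<omega> \<bullet> ?q \<omega> = - h k \<omega>"
        unfolding h_def inner_diff_right by simp
      show "d k \<omega> = ?Z \<omega> \<bullet> ?p \<omega> + ?Z' \<omega> \<bullet> ?q \<omega>"
        unfolding d_def inner_diff_left 1 2 using 3 gap_lagrangian[of k "x k \<omega>" "y k \<omega>"] by linarith
    qed
    \<comment> \<open>Any bounds will do: they only serve the integrability of the products with the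
      noise.\<close>
    have "bounded (X_set \<alpha> \<sigma> :: ('s, 'a) primal set)" "bounded (nonneg_box B \<times> nonneg_box D :: ('s, 'a) dual set)"
      unfolding X_eq nonneg_box_eq_cbox by (intro bounded_Times bounded_cbox)+
    then obtain c c' where c: "\<And>v :: ('s, 'a) primal. v \<in> X_set \<alpha> \<sigma> \<Longrightarrow> norm v \<le> c"
      and c': "\<And>v :: ('s, 'a) dual. v \<in> nonneg_box B \<times> nonneg_box D \<Longrightarrow> norm v \<le> c'"
      unfolding bounded_iff by blast
    have p: "norm (?p \<omega>) \<le> c + c" if "\<omega> \<in> space W" for \<omega>
      using c[OF xs] c[OF x_mem[OF that, of k]] by (intro norm_triangle_le_diff add_mono)
    have q: "norm (?q \<omega>) \<le> c' + c'" if "\<omega> \<in> space W" for \<omega>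
      using y_mem[OF that, of k] u_mem[of k]
      by (intro norm_triangle_le_diff add_mono c') (auto simp: L_eq M_eq Y_set_def)
    have pF: "?p \<in> borel_measurable (F k)" and qF: "?q \<in> borel_measurable (F k)"
      by (intro borel_measurable_diff borel_measurable_const xF yF)+
    have X: "integrable W (\<lambda>\<omega>. ?Z \<omega> \<bullet> ?p \<omega>)"
      "AE \<omega> in W. real_cond_exp W (F k) (\<lambda>\<omega>. ?Z \<omega> \<bullet> ?p \<omega>) \<omega> = 0"
      by (rule cond_mean_zero_inner[OF sub unbx pF], rule p, assumption)+
    have Y: "integrable W (\<lambda>\<omega>. ?Z' \<omega> \<bullet> ?q \<omega>)"
      "AE \<omega> in W. real_cond_exp W (F k) (\<lambda>\<omega>. ?Z' \<omega> \<bullet> ?q \<omega>) \<omega> = 0"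
      by (rule cond_mean_zero_inner[OF sub unby qF], rule q, assumption)+
    show ?thesis
      using Fk.real_cond_exp_add[OF X(1) Y(1)] X(2) Y(2) unfolding d_eq by eventually_elim simp
  qed

  \<comment> \<open>Consequences of the lower bound on T\<close>
  define K where "K = max (kappa1 (real CARD('s)) (real CARD('a)) \<zeta> \<beta>0 \<gamma>0) (kappa2 \<gamma>0)"
  \<comment> \<open>Here \<delta> < 1 / e enters: the regret part carries no logarithm, so the
    factor ln (1 / \<delta>) must be at least 1 to be dropped.\<close>
  have ln\<delta>: "1 \<le> ln (1 / \<delta>)"
  proof -
    have "exp 1 \<le> 1 / \<delta>" using \<delta> by (simp add: field_simps)
    thus ?thesis using \<delta> by (subst ln_ge_iff) auto
  qed
  have "\<sigma> ^ 4 * real CARD('s) ^ 4 * real CARD('a) ^ 4 / (\<zeta> ^ 4 * (1 - \<alpha>) ^ 4) = (D * n) ^ 4"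
    by (simp add: D_def B_def n_def power_mult_distrib power_divide mult_ac)
  with T have "K * (D * n) ^ 4 * (1 / \<epsilon>\<^sup>2) * ln (1 / \<delta>) \<le> real T"
    by (simp add: K_def)
  hence T\<epsilon>: "K * (D * n) ^ 4 * ln (1 / \<delta>) \<le> real T * \<epsilon>\<^sup>2"
    using \<epsilon> by (simp add: field_simps)
  \<comment> \<open>832 is a summand of \<open>kappa2\<close>, and the other summands are
    nonnegative.\<close>
  have K2: "832 \<le> K"
  proof -
    have "832 \<le> kappa2 \<gamma>0" using \<gamma>0 by (simp add: kappa2_def)
    thus ?thesis by (simp add: K_def)
  qed
  have DB: "D * B \<le> (D * n)\<^sup>2"
  proof -
    have Dn: "D \<le> D * n"
      using mult_left_mono[OF n2, of D] D0 by simp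
    from this BD have "B \<le> D * n"
      by linarith
    with Dn have "D * B \<le> (D * n) * (D * n)"
      using B0 D0 n2 by (intro mult_mono) auto
    thus ?thesis by (simp add: power2_eq_square)
  qed
  \<comment> \<open>\<open>512 = 8 * 8^2\<close>: the deviation is \<open>T * \<epsilon> / 2\<close> and the increments are bounded by \<open>8 * D * B\<close>.\<close>
  have T1: "512 * (D * B)\<^sup>2 * ln (1 / \<delta>) \<le> real T * \<epsilon>\<^sup>2"
  proof -
    have "(D * B)\<^sup>2 \<le> ((D * n)\<^sup>2)\<^sup>2"
      using DB D0 B0 by (intro power_mono) auto
    hence "512 * (D * B)\<^sup>2 \<le> K * (D * n) ^ 4"
      using K2 by (intro mult_mono) auto
    hence "512 * (D * B)\<^sup>2 * ln (1 / \<delta>) \<le> K * (D * n) ^ 4 * ln (1 / \<delta>)"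
      using ln\<delta> by (intro mult_right_mono) auto
    with T\<epsilon> show ?thesis by linarith
  qed
  have Tpos: "0 < T"
  proof (rule ccontr)
    assume "\<not> 0 < T"
    moreover have "0 < 512 * (D * B)\<^sup>2 * ln (1 / \<delta>)" using D0 B0 ln\<delta> by simp
    ultimately show False using T1 by simp
  qed
  define reg where "reg = 2 * D\<^sup>2 / (\<zeta> * \<gamma>0) + 2 * \<beta>0 * D\<^sup>2 / \<gamma>0 + 10 * \<gamma>0 * D\<^sup>2"
  have T2: "2 * reg \<le> sqrt (real T) * \<epsilon>"
  proof -
    define q where "q = (12 + 4 * \<beta>0) / (\<zeta>\<^sup>2 * n\<^sup>2 * \<gamma>0) + 26 * \<gamma>0"
    have q0: "0 \<le> q" using \<beta>0 \<gamma>0 by (simp add: q_def)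
    have "q\<^sup>2 \<le> K"
      by (simp add: K_def kappa1_def q_def n_def power_mult_distrib mult.assoc)
    hence "q\<^sup>2 * (D * n) ^ 4 * 1 \<le> K * (D * n) ^ 4 * ln (1 / \<delta>)"
      using ln\<delta> K2 by (intro mult_mono) auto
    also note T\<epsilon>
    also have "q\<^sup>2 * (D * n) ^ 4 * 1 = (q * (D * n)\<^sup>2)\<^sup>2"
      by (simp add: power_mult_distrib)
    finally have "q * (D * n)\<^sup>2 \<le> sqrt (real T * \<epsilon>\<^sup>2)"
      by (rule real_le_rsqrt)
    also have "\<dots> = sqrt (real T) * \<epsilon>"
      using \<epsilon> by (simp add: real_sqrt_mult)
    finally have 1: "q * (D * n)\<^sup>2 \<le> sqrt (real T) * \<epsilon>" .
    \<comment> \<open>The n^2 in the denominator of \<open>q\<close> cancels. Then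
      \<open>2 * reg\<close> is compared term by term, using 1 \<le> 1 / \<zeta> \<le> 1 /
      \<zeta>^2: 4 against 12, 4 \<beta>0 against 4 \<beta>0, and 20 against 26.\<close>
    have 2: "q * (D * n)\<^sup>2 = (12 + 4 * \<beta>0) * D\<^sup>2 / \<gamma>0 * (1 / \<zeta>\<^sup>2) + 26 * \<gamma>0 * (D * n)\<^sup>2"
      using n2 \<zeta>0 \<gamma>0 by (simp add: q_def power_mult_distrib field_simps)
    have \<zeta>1: "\<zeta> \<le> 1"
      using mult_right_mono[OF n2, of \<zeta>] \<zeta>0 n\<zeta> by linarith
    hence i1: "1 \<le> 1 / \<zeta>" using \<zeta>0 by simp
    hence i2: "1 / \<zeta> \<le> 1 / \<zeta>\<^sup>2"
      using mult_left_mono[OF i1, of "1 / \<zeta>"] \<zeta>0 by (simp add: power2_eq_square)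
    have a1: "2 * (2 * D\<^sup>2 / (\<zeta> * \<gamma>0)) \<le> 12 * D\<^sup>2 / \<gamma>0 * (1 / \<zeta>\<^sup>2)"
    proof -
      have "2 * (2 * D\<^sup>2 / (\<zeta> * \<gamma>0)) = 4 * D\<^sup>2 / \<gamma>0 * (1 / \<zeta>)" by (simp add: mult.commute)
      also have "\<dots> \<le> 12 * D\<^sup>2 / \<gamma>0 * (1 / \<zeta>\<^sup>2)"
        using i2 \<gamma>0 \<zeta>0 by (intro mult_mono divide_right_mono) auto
      finally show ?thesis .
    qed
    have a2: "2 * (2 * \<beta>0 * D\<^sup>2 / \<gamma>0) \<le> 4 * \<beta>0 * D\<^sup>2 / \<gamma>0 * (1 / \<zeta>\<^sup>2)"
      using mult_left_mono[of 1 "1 / \<zeta>\<^sup>2" "4 * \<beta>0 * D\<^sup>2 / \<gamma>0"] i1 i2 \<beta>0 \<gamma>0 by simp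
    have "D \<le> D * n" using mult_left_mono[OF n2, of D] D0 by simp
    hence "D\<^sup>2 \<le> (D * n)\<^sup>2" using D0 by (intro power_mono) auto
    hence a3: "2 * (10 * \<gamma>0 * D\<^sup>2) \<le> 26 * \<gamma>0 * (D * n)\<^sup>2"
      using mult_mono[of "20 * \<gamma>0" "26 * \<gamma>0" "D\<^sup>2" "(D * n)\<^sup>2"] \<gamma>0 by simp
    have 3: "(12 + 4 * \<beta>0) * D\<^sup>2 / \<gamma>0 * (1 / \<zeta>\<^sup>2)
        = 12 * D\<^sup>2 / \<gamma>0 * (1 / \<zeta>\<^sup>2) + 4 * \<beta>0 * D\<^sup>2 / \<gamma>0 * (1 / \<zeta>\<^sup>2)"
      by (simp add: add_divide_distrib distrib_right)
    have "2 * reg \<le> q * (D * n)\<^sup>2"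
      unfolding reg_def 2 3 distrib_left[of 2] by (intro add_mono a1 a2 a3)
    with 1 show ?thesis by linarith
  qed

  \<comment> \<open>The exceptional event\<close>
  define t where "t = real T * \<epsilon> / 2"
  define bad where "bad = {\<omega> \<in> space W. t \<le> (\<Sum>k<T. d k \<omega>)}"
  have dM [measurable]: "d k \<in> borel_measurable W" for k
    by (rule measurable_from_subalg[OF F(2) dF])
  have bad_sets: "bad \<in> sets W" unfolding bad_def by measurable
  have prob_bad: "prob bad \<le> \<delta>"
  proof -
    have "prob bad \<le> exp (- (t\<^sup>2 / (2 * real T * (8 * D * B)\<^sup>2)))"
      unfolding bad_def
      by (rule azuma_hoeffding[OF F dF d_bound d_mean]) (use D0 B0 Tpos \<epsilon> in \<open>auto simp: t_def\<close>)
    also have "t\<^sup>2 / (2 * real T * (8 * D * B)\<^sup>2) = real T * \<epsilon>\<^sup>2 / (512 * (D * B)\<^sup>2)"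
      using Tpos by (simp add: t_def power_mult_distrib power2_eq_square field_simps)
    also have "exp (- (real T * \<epsilon>\<^sup>2 / (512 * (D * B)\<^sup>2))) \<le> exp (- ln (1 / \<delta>))"
    proof -
      have "ln (1 / \<delta>) \<le> real T * \<epsilon>\<^sup>2 / (512 * (D * B)\<^sup>2)"
        using T1 D0 B0 by (subst pos_le_divide_eq) (auto simp: mult_ac)
      thus ?thesis by simp
    qed
    also have "\<dots> = \<delta>" using \<delta> by (simp add: ln_div)
    finally show ?thesis .
  qed
  \<comment> \<open>The weights 1 / T sum to one, which preserves the constant part of
    \<open>gap\<close>; the \<lambda> component of the average carries no matrix weight.\<close>
  have gap_avg: "gap (fst (y_average M (\<lambda>k. y k \<omega>) T)) = (1 / real T) * (\<Sum>k<T. gap (fst (y k \<omega>)))" for \<omega>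
  proof -
    have "fst (y_average M (\<lambda>k. y k \<omega>) T) = (1 / real T) *\<^sub>R (\<Sum>k<T. fst (y k \<omega>))"
      by (simp add: y_average_def fst_sum)
    thus ?thesis
      using Tpos by (simp add: gap_def sum_subtractf sum.distrib inner_sum_left field_simps)
  qed
  define good where "good = {\<omega> \<in> space W. (1 / real T) * (\<Sum>k<T. gap (fst (y k \<omega>))) \<le> \<epsilon>}"
  have good_sets: "good \<in> sets W"
  proof -
    have [measurable]: "(\<lambda>\<omega>. gap (fst (y k \<omega>))) \<in> borel_measurable W" for k
      by (rule measurable_compose[OF measurable_from_subalg[OF F(2) yF] gap_meas])
    show ?thesis unfolding good_def by measurable
  qed
  \<comment> \<open>The inclusion holds only almost everywhere, because the rewards are bounded only
    off a null set.\<close>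
  have "AE \<omega> in W. \<omega> \<in> space W - bad \<longrightarrow> \<omega> \<in> good"
    using rew_AE AE_space
  proof eventually_elim
    case (elim \<omega>)
    note \<omega> = elim(2)
    show ?case
    proof
      assume "\<omega> \<in> space W - bad"
      hence "(\<Sum>k<T. d k \<omega>) \<le> t" by (auto simp: bad_def)
      moreover have "(\<Sum>k<T. h k \<omega>) \<le> sqrt (real T) * reg"
        unfolding h_def reg_def
      proof (rule spd_regret[OF B_def D_def \<eta>(1) _ \<zeta>0 \<gamma>0 _ n\<zeta>[unfolded n_def] gxk_bounds(1)[OF \<omega>] gyk_bounds(1)[OF \<omega>]
            x_mem[OF \<omega>] xstep[OF \<omega>, unfolded \<gamma>] y_mem[OF \<omega>] ystep[OF \<omega>, unfolded \<gamma>] xs u_mem w_drift])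
      qed (use elim(1) B0 \<beta>0 in auto)
      moreover have "sqrt (real T) * reg \<le> t"
      proof -
        have "sqrt (real T) * (2 * reg) \<le> sqrt (real T) * (sqrt (real T) * \<epsilon>)"
          using T2 by (intro mult_left_mono) auto
        thus ?thesis by (simp add: t_def flip: mult.assoc)
      qed
      moreover have "(\<Sum>k<T. gap (fst (y k \<omega>))) = (\<Sum>k<T. h k \<omega>) + (\<Sum>k<T. d k \<omega>)"
        by (simp add: d_def flip: sum.distrib)
      ultimately have "(\<Sum>k<T. gap (fst (y k \<omega>))) \<le> real T * \<epsilon>"
        unfolding t_def by linarith
      thus "\<omega> \<in> good"
        using Tpos \<omega> by (simp add: good_def field_simps)
    qed
  qed
  hence "prob (space W - bad) \<le> prob good"
    by (rule finite_measure_mono_AE[OF _ good_sets])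
  hence "1 - \<delta> \<le> prob good"
    using prob_compl[OF bad_sets] prob_bad by linarith
  thus ?thesis
    by (simp add: pseudo_gap_eq gap_avg good_def)
qed

end
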